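(* Let $p(\mathbf{x};t)$ be the Gaussian probability density on $\mathbb{R}^n$ with mean $\boldsymbol{\mu}(t)$ and positive definite covariance $\boldsymbol{\Sigma}(t)$, governed by $$\dot{\boldsymbol{\mu}}=\mathbf{A}\boldsymbol{\mu}+\mathbf{B}\mathbf{u}(t),\qquad \dot{\boldsymbol{\Sigma}}=\mathbf{A}\boldsymbol{\Sigma}+\boldsymbol{\Sigma}\mathbf{A}^\top+2\mathbf{D},$$ where $\mathbf{A}\in\mathbb{R}^{n\times n}$, $\mathbf{B}\in\mathbb{R}^{n\times p}$ are constant, $\mathbf{u}(t)\in\mathbb{R}^p$ is continuous, and $\mathbf{D}=\mathbf{D}(t)$ is diagonal with $D_{ii}>0$ for all $i$. Let $\Gamma$, $\Pi$, $\dot S$ be the information rate, entropy production and entropy rate of $p$, and let $\dot S_{J_i}=\Pi_{J_i}-\Phi_{J_i}$ be the contribution of the current $J_i$ to the entropy rate. Then at every time $t$ $$0\le\Gamma^2\le\mathcal{E}_u:=\operatorname{Tr}(\boldsymbol{\Sigma}^{-1})\,\Pi\,\operatorname{Tr}(\mathbf{D})+\dot S^2-2g(\mathbf{s}),$$ where $\mathbf{s}=[\dot S_{J_1},\dots,\dot S_{J_n}]^\top$ and $g(\mathbf{s}):=\sum_{1\le i<j\le n}\dot S_{J_i}\dot S_{J_j}$.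
   Context: The process is the linear Langevin system $\dot x_i=f_i(\mathbf{x};t)+\xi_i(t)$, $i=1,\dots,n$, with $f_i(\mathbf{x};t)=\sum_{j=1}^n a_{ij}x_j+\sum_{j} b_{ij}u_j(t)$, where $\mathbf{A}=(a_{ij})$, $\mathbf{B}=(b_{ij})$, and noise satisfying $\langle\xi_i(t)\rangle=0$, $\langle\xi_i(t)\xi_j(t')\rangle=2D_{ij}\delta(t-t')$. Its density solves the Fokker-Planck equation $\partial_t p=-\sum_i\partial_{x_i}J_i$ with probability current $$J_i(\mathbf{x};t)=f_i(\mathbf{x};t)p(\mathbf{x};t)-\sum_j D_{ij}\,\partial_{x_j}p(\mathbf{x};t).$$ For Gaussian initial data the density is $p(\mathbf{x};t)=\det(2\pi\boldsymbol{\Sigma}(t))^{-1/2}\exp\left(-\tfrac12(\mathbf{x}-\boldsymbol{\mu}(t))^\top\boldsymbol{\Sigma}(t)^{-1}(\mathbf{x}-\boldsymbol{\mu}(t))\right)$ with $\boldsymbol\mu,\boldsymbol\Sigma$ solving the equations in the claim. Definitions (for $\mathbf{D}$ diagonal with positive diagonal entries): - Contributions of the current $J_i$: $\Pi_{J_i}=\int_{\mathbb{R}^n}\frac{J_i(\mathbf{x};t)^2}{D_{ii}\,p(\mathbf{x};t)}\,d^nx$ and $\Phi_{J_i}=\int_{\mathbb{R}^n}\frac{J_i(\mathbf{x};t)f_i(\mathbf{x};t)}{D_{ii}}\,d^nx$. - Entropy production: $\Pi=\sum_i\Pi_{J_i}$. - Entropy rate: $\dot S=-\int_{\mathbb{R}^n}\partial_t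 p(\mathbf{x};t)\ln p(\mathbf{x};t)\,d^nx$, which equals $\sum_i\dot S_{J_i}$, where $\dot S_{J_i}=\int_{\mathbb{R}^n}\partial_{x_i}J_i(\mathbf{x};t)\,\ln p(\mathbf{x};t)\,d^nx=\Pi_{J_i}-\Phi_{J_i}$. - Information rate: $\Gamma(t)=\sqrt{\int_{\mathbb{R}^n}p(\mathbf{x};t)\left[\partial_t\ln p(\mathbf{x};t)\right]^2d^nx}$. *)

theory Defs
  imports "HOL-Analysis.Analysis"
begin

definition pos_definite :: "real^'n^'n \<Rightarrow> bool" where
  "pos_definite S \<longleftrightarrow> transpose S = S \<and> (\<forall>x. x \<noteq> 0 \<longrightarrow> x \<bullet> (S *v x) > 0)"

definition gaussian_density :: "real^'n \<Rightarrow> real^'n^'n \<Rightarrow> real^'n \<Rightarrow> real" where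
  "gaussian_density m S x =
     det ((2 * pi) *\<^sub>R S) powr (-1/2) * exp (- (1/2) * ((x - m) \<bullet> (matrix_inv S *v (x - m))))"

definition linear_drift :: "real^'n^'n \<Rightarrow> real^'m^'n \<Rightarrow> real^'m \<Rightarrow> real^'n \<Rightarrow> real^'n" where
  "linear_drift A B v x = A *v x + B *v v"

definition partial_deriv :: "'n \<Rightarrow> (real^'n \<Rightarrow> real) \<Rightarrow> real^'n \<Rightarrow> real" where
  "partial_deriv j q x = deriv (\<lambda>h. q (x + h *\<^sub>R axis j 1)) 0"

text \<open>
  The functions without a time argument take the drift \<open>f\<close>, the diffusion matrix \<open>D\<close> and
  the density \<open>q\<close> at one instant.
\<close>

definition current ::
  "(real^'n \<Rightarrow> real^'n) \<Rightarrow> real^'n^'n \<Rightarrow> (real^'n \<Rightarrow> real) \<Rightarrow> 'n \<Rightarrow> real^'n \<Rightarrow> real" where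
  "current f D q i x = f x $ i * q x - (\<Sum>j\<in>UNIV. D $ i $ j * partial_deriv j q x)"

definition Pi_current ::
  "(real^'n \<Rightarrow> real^'n) \<Rightarrow> real^'n^'n \<Rightarrow> (real^'n \<Rightarrow> real) \<Rightarrow> 'n \<Rightarrow> real" where
  "Pi_current f D q i = (LINT x|lborel. (current f D q i x)\<^sup>2 / (D $ i $ i * q x))"

definition Phi_current ::
  "(real^'n \<Rightarrow> real^'n) \<Rightarrow> real^'n^'n \<Rightarrow> (real^'n \<Rightarrow> real) \<Rightarrow> 'n \<Rightarrow> real" where
  "Phi_current f D q i = (LINT x|lborel. current f D q i x * f x $ i / D $ i $ i)"

definition entropy_production ::
  "(real^'n \<Rightarrow> real^'n) \<Rightarrow> real^'n^'n \<Rightarrow> (real^'n \<Rightarrow> real) \<Rightarrow> real" where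
  "entropy_production f D q = (\<Sum>i\<in>UNIV. Pi_current f D q i)"

definition entropy_rate_current ::
  "(real^'n \<Rightarrow> real^'n) \<Rightarrow> real^'n^'n \<Rightarrow> (real^'n \<Rightarrow> real) \<Rightarrow> 'n \<Rightarrow> real" where
  "entropy_rate_current f D q i = Pi_current f D q i - Phi_current f D q i"

text \<open>
  Time derivatives are taken within the time interval \<open>T\<close>, hence one-sided at an endpoint
  of \<open>T\<close> and two-sided at every interior point.
\<close>

definition entropy_rate :: "real set \<Rightarrow> (real \<Rightarrow> real^'n \<Rightarrow> real) \<Rightarrow> real \<Rightarrow> real" where
  "entropy_rate T p t =
     - (LINT x|lborel. vector_derivative (\<lambda>s. p s x) (at t within T) * ln (p t x))"

definition information_rate :: "real set \<Rightarrow> (real \<Rightarrow> real^'n \<Rightarrow> real) \<Rightarrow> real \<Rightarrow> real" where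
  "information_rate T p t =
     sqrt (LINT x|lborel. p t x * (vector_derivative (\<lambda>s. ln (p s x)) (at t within T))\<^sup>2)"

definition pair_sum :: "real^'n::{finite,linorder} \<Rightarrow> real" where
  "pair_sum s = (\<Sum>(i, j)\<in>{(i, j). i < j}. s $ i * s $ j)"

end

theory Submission
  imports Defs "HOL-Probability.Distributions"
begin

text \<open>
  Factor \<open>S = C C\<^sup>T\<close>, put \<open>J = C\<^sup>-\<^sup>1\<close> and substitute \<open>x = \<mu> + C z\<close> with \<open>z\<close> standard Gaussian.
  With \<open>v = A \<mu> + B u\<close>, \<open>M = A + D S\<^sup>-\<^sup>1\<close>, \<open>L = M C\<close> and \<open>N = J L\<close> one has
  \<open>v\<^sub>i + (L z)\<^sub>i\<close> for the \<open>i\<close>-th probability current divided by \<open>p\<close>, and \<open>\<partial>\<^sub>t ln p = - Tr M + (J v) \<bullet> z + z \<bullet> N z\<close>. Gaussian moments up to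
  order four then give that the \<open>i\<close>-th contribution to the entropy rate is \<open>M\<^sub>i\<^sub>i\<close>, that the
  entropy rate is \<open>Tr M\<close>, that the entropy production is
  \<open>\<Sum>\<^sub>i r\<^sub>i / D\<^sub>i\<^sub>i\<close> with \<open>r\<^sub>i = v\<^sub>i\<^sup>2 + |L\<^sub>i|\<^sup>2\<close> (\<open>L\<^sub>i\<close> the \<open>i\<close>-th row of \<open>L\<close>), and that the squared information rate is
  \<open>|J v|\<^sup>2 + |N|\<^sup>2 + Tr (N\<^sup>2)\<close>, with \<open>Tr (N\<^sup>2) = Tr (M\<^sup>2)\<close>.

  With \<open>\<tau> = Tr S\<^sup>-\<^sup>1 = |J|\<^sup>2\<close>, Cauchy-Schwarz bounds the first two terms by \<open>\<tau> \<Sum>\<^sub>i r\<^sub>i\<close>, the diagonal part of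
  \<open>\<tau> (Tr D) \<Sum>\<^sub>i r\<^sub>i / D\<^sub>i\<^sub>i\<close>. The off-diagonal part absorbs \<open>\<Sum>\<^sub>i\<^sub>\<noteq>\<^sub>j M\<^sub>i\<^sub>j M\<^sub>j\<^sub>i\<close>, because
  \<open>2 M\<^sub>i\<^sub>j M\<^sub>j\<^sub>i \<le> (D\<^sub>j\<^sub>j / D\<^sub>i\<^sub>i) M\<^sub>i\<^sub>j\<^sup>2 + (D\<^sub>i\<^sub>i / D\<^sub>j\<^sub>j) M\<^sub>j\<^sub>i\<^sup>2\<close> and \<open>M\<^sub>i\<^sub>j\<^sup>2 \<le> \<tau> r\<^sub>i\<close>. What remains of
  \<open>Tr (M\<^sup>2)\<close> is \<open>\<Sum>\<^sub>i M\<^sub>i\<^sub>i\<^sup>2\<close>, the squared entropy rate minus \<open>2 g\<close>.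
\<close>

subsection \<open>Affine substitution in Lebesgue integrals\<close>

lemma borel_measurable_matrix_vector_mult:
  fixes A :: "real^'n^'m"
  shows "(*v) A \<in> borel_measurable borel"
  by (intro borel_measurable_continuous_onI linear_continuous_on) simp

text \<open>With the other coordinates held fixed, the map translates the \<open>m\<close>-th
  coordinate, by an amount independent of that coordinate because \<open>m \<noteq> n\<close>.
  Fubini and translation invariance on the line then finish.\<close>

lemma nn_integral_lborel_shear:
  fixes g :: "real^'n \<Rightarrow> ennreal"
  assumes [measurable]: "g \<in> borel_measurable borel" and "m \<noteq> n"
  shows "(\<integral>\<^sup>+x. g (x + (c * x $ n) *\<^sub>R axis m 1) \<partial>lborel) = (\<integral>\<^sup>+x. g x \<partial>lborel)"
proof -
  interpret product_sigma_finite "\<lambda>_::real^'n. lborel :: real measure" ..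
  define e :: "real^'n" where "e = axis m 1"
  define I where "I = Basis - {e}"
  have e: "e \<in> Basis" and B: "Basis = insert e I" "finite I" "e \<notin> I"
    by (auto simp: e_def I_def axis_in_Basis_iff)
  \<comment> \<open>\<open>R\<close> rebuilds a vector from its coordinates over
    \<open>Basis\<close>; \<open>R0\<close> leaves out the direction \<open>e\<close>, which is
    integrated innermost.\<close>
  define R where "R f = (\<Sum>b\<in>Basis. f b *\<^sub>R b)" for f :: "real^'n \<Rightarrow> real"
  define R0 where "R0 f = (\<Sum>b\<in>I. f b *\<^sub>R b)" for f :: "real^'n \<Rightarrow> real"
  have R: "R (f(e := y)) = R0 f + y *\<^sub>R e" for f y
    unfolding R_def R0_def B(1) using B(2,3) by (auto intro!: sum.cong)
  have [measurable]: "R \<in> borel_measurable (\<Pi>\<^sub>M b\<in>Basis. lborel)"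
    unfolding R_def by measurable
  have en: "e $ n = 0"
    using \<open>m \<noteq> n\<close> by (simp add: e_def axis_def)
  have split: "(\<integral>\<^sup>+x. h x \<partial>lborel) = (\<integral>\<^sup>+f. \<integral>\<^sup>+y. h (R0 f + y *\<^sub>R e) \<partial>lborel \<partial>(\<Pi>\<^sub>M b\<in>I. lborel))"
    if [measurable]: "h \<in> borel_measurable borel" for h :: "real^'n \<Rightarrow> ennreal"
  proof -
    have "(\<integral>\<^sup>+x. h x \<partial>lborel) = (\<integral>\<^sup>+f. h (R f) \<partial>(\<Pi>\<^sub>M b\<in>Basis. lborel))"
      unfolding R_def by (subst lborel_eq) (simp add: nn_integral_distr)
    also have "\<dots> = (\<integral>\<^sup>+f. \<integral>\<^sup>+y. h (R (f(e := y))) \<partial>lborel \<partial>(\<Pi>\<^sub>M b\<in>I. lborel))"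
      unfolding B(1) using B(2,3)
      by (intro product_nn_integral_insert) (simp_all add: B(1)[symmetric])
    finally show ?thesis
      by (simp add: R)
  qed
  have "(\<integral>\<^sup>+y. g (R0 f + y *\<^sub>R e + (c * (R0 f + y *\<^sub>R e) $ n) *\<^sub>R e) \<partial>lborel) =
      (\<integral>\<^sup>+y. g (R0 f + y *\<^sub>R e) \<partial>lborel)" for f
    by (subst (2) nn_integral_real_affine[where c = 1 and t = "c * R0 f $ n"])
       (simp_all add: en algebra_simps)
  then show ?thesis
    by (simp add: split e_def[symmetric])
qed

text \<open>Induction over a generating family of matrices: the formula is stable under products,
  and each generator scales, swaps or shears coordinates or else is singular.\<close>

lemma nn_integral_lborel_linear:
  fixes A :: "real^'n^'n"
  assumes "det A \<noteq> 0" "g \<in> borel_measurable borel"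
  shows "(\<integral>\<^sup>+x. g x \<partial>lborel) = \<bar>det A\<bar> * (\<integral>\<^sup>+x. g (A *v x) \<partial>lborel)"
proof -
  \<comment> \<open>\<open>g\<close> is quantified inside \<open>Q\<close> because the product case
    also needs the formula at \<open>\<lambda>x. g (A *v x)\<close>. The premise
    \<open>det A \<noteq> 0\<close> makes the zero-row case vacuous.\<close>
  define Q where "Q A \<longleftrightarrow> (det A \<noteq> 0 \<longrightarrow> (\<forall>g \<in> borel_measurable borel.
      (\<integral>\<^sup>+x. g x \<partial>lborel) = \<bar>det A\<bar> * (\<integral>\<^sup>+x. g (A *v x) \<partial>lborel)))" for A :: "real^'n^'n"
  have "Q A"
  proof (induction A rule: induct_matrix_elementary)
    case (1 A B)
    show ?case
      unfolding Q_def
    proof (intro impI ballI)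
      fix g :: "real^'n \<Rightarrow> ennreal"
      assume d: "det (A ** B) \<noteq> 0" and g[measurable]: "g \<in> borel_measurable borel"
      note borel_measurable_matrix_vector_mult[of A, measurable]
      have "(\<lambda>x. g (A *v x)) \<in> borel_measurable borel"
        by measurable
      then show "(\<integral>\<^sup>+x. g x \<partial>lborel) = \<bar>det (A ** B)\<bar> * (\<integral>\<^sup>+x. g ((A ** B) *v x) \<partial>lborel)"
        using 1 d g
        by (simp add: Q_def det_mul abs_mult ennreal_mult matrix_vector_mul_assoc mult.assoc)
    qed
  next
    case (2 A i)
    then have "det A = 0"
      by (metis det_zero_row(2))
    then show ?case
      by (simp add: Q_def)
  next
    case (3 A)
    show ?case
      unfolding Q_def
    proof (intro impI ballI)
      fix g :: "real^'n \<Rightarrow> ennreal"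
      assume d: "det A \<noteq> 0" and g[measurable]: "g \<in> borel_measurable borel"
      note borel_measurable_matrix_vector_mult[of A, measurable]
      define c where "c b = b \<bullet> (A *v b)" for b :: "real^'n"
      have dA: "det A = (\<Prod>i\<in>UNIV. A $ i $ i)"
        by (rule det_diagonal) (use 3 in auto)
      have c: "c (axis i 1) = A $ i $ i" for i
        by (simp add: c_def inner_axis' matrix_vector_mult_basis column_def)
      have Basis: "(Basis :: (real^'n) set) = range (\<lambda>i. axis i 1)"
        by (auto simp: Basis_vec_def)
      have inj: "inj (\<lambda>i::'n. axis i (1::real))"
        by (auto simp: inj_on_def axis_eq_axis)
      \<comment> \<open>The translation by \<open>0\<close> puts the diagonal map in the shape of
        \<open>lborel_affine_euclidean\<close>, with one scale factor \<open>c j\<close> per basis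
        vector.\<close>
      have Ax: "A *v x = 0 + (\<Sum>j\<in>Basis. (c j * (x \<bullet> j)) *\<^sub>R j)" for x
      proof -
        have "(\<Sum>j\<in>UNIV. A $ i $ j * x $ j) = (\<Sum>j\<in>UNIV. if j = i then A $ i $ i * x $ i else 0)" for i
          by (rule sum.cong) (use 3 in auto)
        then show ?thesis
          unfolding vec_eq_iff
          by (simp add: Basis sum.reindex[OF inj] c matrix_vector_mult_def inner_axis)
             (simp add: axis_def if_distrib cong: if_cong)
      qed
      have "lborel = density (distr lborel borel (\<lambda>x. A *v x)) (\<lambda>_. (\<Prod>j\<in>Basis. \<bar>c j\<bar>))"
        unfolding Ax
        by (rule lborel_affine_euclidean) (use d in \<open>auto simp: Basis c dA\<close>)
      also have "(\<Prod>j\<in>Basis. \<bar>c j\<bar>) = \<bar>det A\<bar>"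
        by (simp add: Basis prod.reindex[OF inj] c dA abs_prod)
      finally have *: "lborel = density (distr lborel borel (\<lambda>x. A *v x)) (\<lambda>_. \<bar>det A\<bar>)" .
      show "(\<integral>\<^sup>+x. g x \<partial>lborel) = \<bar>det A\<bar> * (\<integral>\<^sup>+x. g (A *v x) \<partial>lborel)"
        by (subst *) (simp add: nn_integral_density nn_integral_distr nn_integral_cmult)
    qed
  next
    case (4 m n)
    let ?\<pi> = "Transposition.transpose m n"
    let ?A = "(\<chi> i j. mat 1 $ i $ ?\<pi> j) :: real^'n^'n"
    have "?\<pi> permutes UNIV"
      by (simp add: permutes_swap_id)
    then have "det ?A = of_int (sign ?\<pi>) * det (mat 1 :: real^'n^'n)"
      by (rule det_permute_columns)
    then have d: "\<bar>det ?A\<bar> = 1"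
      by (simp add: sign_def)
    have A: "(?A *v x) $ i = x $ ?\<pi> i" for x i
    proof -
      have "(\<Sum>j\<in>UNIV. (if i = ?\<pi> j then 1 else 0) * x $ j) =
          (\<Sum>j\<in>UNIV. if j = ?\<pi> i then x $ ?\<pi> i else 0)"
        by (rule sum.cong) auto
      then show ?thesis
        by (simp add: matrix_vector_mult_def mat_def)
    qed
    note borel_measurable_matrix_vector_mult[of ?A, measurable]
    \<comment> \<open>Swapping two coordinates carries boxes to boxes of the same volume, and
      Lebesgue measure is determined by its values on boxes.\<close>
    have eq: "lborel = distr lborel borel (\<lambda>x. ?A *v x)"
    proof (rule lborel_eqI)
      fix l u :: "real^'n"
      assume le: "\<And>b. b \<in> Basis \<Longrightarrow> l \<bullet> b \<le> u \<bullet> b"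
      have lu: "l $ i \<le> u $ i" for i
        using le[of "axis i 1"] by (simp add: inner_axis axis_in_Basis_iff)
      have bij: "bij ?\<pi>"
        by simp
      have inj: "inj (\<lambda>i::'n. axis i (1::real))"
        by (auto simp: inj_on_def axis_eq_axis)
      have Basis: "(Basis :: (real^'n) set) = range (\<lambda>i. axis i 1)"
        by (auto simp: Basis_vec_def)
      have "(\<lambda>x. ?A *v x) -` box l u = box (?A *v l) (?A *v u)"
        unfolding set_eq_iff vimage_eq mem_box_cart A
        by (metis transpose_involutory)
      then have "emeasure (distr lborel borel (\<lambda>x. ?A *v x)) (box l u) = emeasure lborel (box (?A *v l) (?A *v u))"
        by (simp add: emeasure_distr)
      also have "\<dots> = (\<Prod>b\<in>Basis. (?A *v u - ?A *v l) \<bullet> b)"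
        by (rule emeasure_lborel_box) (auto simp: Basis inner_axis A lu)
      also have "(\<Prod>b\<in>Basis. (?A *v u - ?A *v l) \<bullet> b) = (\<Prod>i\<in>UNIV. (u - l) $ ?\<pi> i)"
        by (simp add: Basis prod.reindex[OF inj] inner_axis A)
      also have "\<dots> = (\<Prod>i\<in>UNIV. (u - l) $ i)"
        by (rule prod.reindex_bij_betw[OF bij])
      also have "\<dots> = (\<Prod>b\<in>Basis. (u - l) \<bullet> b)"
        by (simp add: Basis prod.reindex[OF inj] inner_axis)
      finally show "emeasure (distr lborel borel (\<lambda>x. ?A *v x)) (box l u) = (\<Prod>b\<in>Basis. (u - l) \<bullet> b)" .
    qed simp
    have "(\<integral>\<^sup>+x. g x \<partial>lborel) = \<bar>det ?A\<bar> * (\<integral>\<^sup>+x. g (?A *v x) \<partial>lborel)"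
      if [measurable]: "g \<in> borel_measurable borel" for g :: "real^'n \<Rightarrow> ennreal"
      unfolding d ennreal_1 mult_1_left by (subst eq, rule nn_integral_distr) measurable
    then show ?case
      unfolding Q_def by blast
  next
    case (5 m n c)
    let ?A = "(\<chi> i j. if i = m \<and> j = n then c else of_bool (i = j)) :: real^'n^'n"
    \<comment> \<open>\<open>?A\<close> is the identity with \<open>c\<close> times row
      \<open>n\<close> added to row \<open>m\<close>, an operation that keeps the
      determinant.\<close>
    have "?A = (\<chi> k. if k = m then row m (mat 1) + c *s row n (mat 1) else row k (mat 1))"
      using 5 by (auto simp: vec_eq_iff row_def mat_def)
    then have d: "det ?A = 1"
      using det_row_operation[OF 5, of "mat 1 :: real^'n^'n" c] by simp
    have A: "?A *v x = x + (c * x $ n) *\<^sub>R axis m 1" for x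
    proof -
      have "(\<Sum>j\<in>UNIV. (if i = m \<and> j = n then c else of_bool (i = j)) * x $ j) =
          (\<Sum>j\<in>UNIV. (if j = i then x $ i else 0) + (if j = n then (if i = m then c * x $ n else 0) else 0))" for i
        by (rule sum.cong) (use 5 in auto)
      then show ?thesis
        by (simp add: vec_eq_iff matrix_vector_mult_def sum.distrib axis_def)
    qed
    show ?case
      unfolding Q_def d A using 5 by (simp add: nn_integral_lborel_shear)
  qed
  then show ?thesis
    using assms by (simp add: Q_def)
qed

lemma nn_integral_lborel_affine:
  fixes A :: "real^'n^'n"
  assumes "det A \<noteq> 0" and [measurable]: "g \<in> borel_measurable borel"
  shows "(\<integral>\<^sup>+x. g x \<partial>lborel) = \<bar>det A\<bar> * (\<integral>\<^sup>+x. g (m + A *v x) \<partial>lborel)"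
proof -
  have "(\<integral>\<^sup>+x. g x \<partial>lborel) = (\<integral>\<^sup>+x. g (m + x) \<partial>lborel)"
    using nn_integral_distr[of "(+) m" lborel borel g] by (simp add: lborel_distr_plus)
  also have "\<dots> = \<bar>det A\<bar> * (\<integral>\<^sup>+x. g (m + A *v x) \<partial>lborel)"
    by (rule nn_integral_lborel_linear[OF assms(1)]) measurable
  finally show ?thesis .
qed

subsection \<open>Moments of the standard Gaussian\<close>

lemma has_bochner_integral_lborel_prod:
  fixes f :: "'n::finite \<Rightarrow> real \<Rightarrow> real"
  assumes "\<And>i. has_bochner_integral lborel (f i) (c i)"
  shows "has_bochner_integral lborel (\<lambda>x::real^'n. \<Prod>i\<in>UNIV. f i (x $ i)) (\<Prod>i\<in>UNIV. c i)"
proof -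
  interpret product_sigma_finite "\<lambda>_::real^'n. lborel :: real measure" ..
  let ?P = "\<Pi>\<^sub>M b\<in>(Basis::(real^'n) set). (lborel :: real measure)"
  let ?R = "\<lambda>g. \<Sum>b\<in>(Basis::(real^'n) set). g b *\<^sub>R b"
  let ?e = "\<lambda>i::'n. axis i (1::real)"
  have Basis: "(Basis :: (real^'n) set) = range ?e"
    by (auto simp: Basis_vec_def)
  have inj: "inj ?e"
    by (auto simp: inj_on_def axis_eq_axis)
  \<comment> \<open>The product measure behind \<open>lborel\<close> is indexed by basis vectors, so
    the factors are reindexed along \<open>?e\<close>.\<close>
  define F where "F b = f (inv ?e b)" for b
  have F: "F (?e i) = f i" for i
    by (simp add: F_def inv_f_f[OF inj])
  have int: "integrable lborel (f i)" "integral\<^sup>L lborel (f i) = c i" for i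
    using assms[of i] by (auto simp: has_bochner_integral_iff)
  then have meas: "f i \<in> borel_measurable borel" for i
    using borel_measurable_integrable by fastforce
  have FB: "integrable lborel (F b)" if "b \<in> Basis" for b
    using that int by (auto simp: Basis F)
  have "has_bochner_integral ?P (\<lambda>g. \<Prod>b\<in>Basis. F b (g b)) (\<Prod>b\<in>Basis. integral\<^sup>L lborel (F b))"
    using FB by (simp add: has_bochner_integral_iff product_integrable_prod product_integral_prod)
  also have "(\<Prod>b\<in>Basis. integral\<^sup>L lborel (F b)) = (\<Prod>i\<in>UNIV. c i)"
    by (simp add: Basis prod.reindex[OF inj] F int)
  also have "(\<lambda>g. \<Prod>b\<in>Basis. F b (g b)) = (\<lambda>g. \<Prod>i\<in>UNIV. f i (?R g $ i))"
    by (simp add: Basis sum.reindex[OF inj] prod.reindex[OF inj] F)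
       (simp add: axis_def if_distrib cong: if_cong)
  finally have "has_bochner_integral ?P (\<lambda>g. \<Prod>i\<in>UNIV. f i (?R g $ i)) (\<Prod>i\<in>UNIV. c i)" .
  moreover have "(\<lambda>x::real^'n. \<Prod>i\<in>UNIV. f i (x $ i)) \<in> borel_measurable borel"
    using meas[measurable] by measurable
  ultimately have "has_bochner_integral (distr ?P borel ?R) (\<lambda>x::real^'n. \<Prod>i\<in>UNIV. f i (x $ i)) (\<Prod>i\<in>UNIV. c i)"
    by (intro has_bochner_integral_distr) simp_all
  then show ?thesis
    by (simp add: lborel_eq[symmetric])
qed

text \<open>Written as a product of one-dimensional densities, so that integrals of monomials factor
  over the coordinates.\<close>

definition std_gaussian :: "(real^'n) measure" where
  "std_gaussian = density lborel (\<lambda>z. \<Prod>i\<in>UNIV. std_normal_density (z $ i))"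

lemma space_std_gaussian [simp]: "space std_gaussian = UNIV"
  and sets_std_gaussian [simp, measurable_cong]: "sets std_gaussian = sets borel"
  by (simp_all add: std_gaussian_def)

text \<open>The \<open>k\<close>-th moment of a standard normal variable; for even \<open>k\<close>
  it is the double factorial of \<open>k - 1\<close>.\<close>

definition std_moment :: "nat \<Rightarrow> real" where
  "std_moment k = (if even k then fact k / (2 ^ (k div 2) * fact (k div 2)) else 0)"

lemma has_bochner_integral_std_moment:
  "has_bochner_integral lborel (\<lambda>x. std_normal_density x * x ^ k) (std_moment k)"
proof (cases "even k")
  case True
  then obtain l where "k = 2 * l" by blast
  then show ?thesis
    using std_normal_moment_even[of l] by (simp add: std_moment_def)
next
  case False
  then obtain l where "k = 2 * l + 1" using oddE by blast
  then show ?thesis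
    using std_normal_moment_odd[of l] by (simp add: std_moment_def)
qed

lemma std_moment_simps [simp]:
  "std_moment 0 = 1" "std_moment (Suc 0) = 0" "std_moment 2 = 1"
  "std_moment 3 = 0" "std_moment 4 = 3"
  by (simp_all add: std_moment_def fact_numeral)

lemma std_gaussian_monomial:
  fixes k :: "'n::finite \<Rightarrow> nat"
  shows "has_bochner_integral std_gaussian (\<lambda>z. \<Prod>i\<in>UNIV. z $ i ^ k i) (\<Prod>i\<in>UNIV. std_moment (k i))"
  unfolding std_gaussian_def
proof (rule has_bochner_integral_density)
  show "has_bochner_integral lborel
      (\<lambda>z. (\<Prod>i\<in>UNIV. std_normal_density (z $ i)) *\<^sub>R (\<Prod>i\<in>UNIV. z $ i ^ k i))
      (\<Prod>i\<in>UNIV. std_moment (k i))"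
    using has_bochner_integral_lborel_prod[OF has_bochner_integral_std_moment, of k]
    by (simp add: prod.distrib)
qed (auto intro!: AE_I2 prod_nonneg)

lemma std_gaussian_moment0: "has_bochner_integral std_gaussian (\<lambda>z::real^'n. 1) (1::real)"
  using std_gaussian_monomial[of "\<lambda>_::'n. 0"] by simp

text \<open>Writes a coordinate as a monomial with an exponent function, the form that
  \<open>std_gaussian_monomial\<close> integrates.\<close>

lemma prod_power_of_bool:
  fixes z :: "'a::comm_monoid_mult^'n"
  shows "(\<Prod>a\<in>UNIV. z $ a ^ of_bool (a = i)) = z $ i"
proof -
  have "(\<Prod>a\<in>UNIV. z $ a ^ of_bool (a = i)) = (\<Prod>a\<in>UNIV. if a = i then z $ i else 1)"
    by (rule prod.cong) auto
  then show ?thesis by simp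
qed

text \<open>Wick's formula: one term for each pairing of the four indices.\<close>

lemma std_gaussian_moment4:
  fixes i j k l :: "'n::finite"
  shows "has_bochner_integral std_gaussian (\<lambda>z. z $ i * z $ j * z $ k * z $ l)
    (of_bool (i = j \<and> k = l) + of_bool (i = k \<and> j = l) + of_bool (i = l \<and> j = k))"
proof -
  \<comment> \<open>\<open>e a\<close> is the multiplicity of \<open>a\<close> among the four
    indices. All other indices have exponent 0 and contribute the factor 1.\<close>
  define e where "e a = of_bool (a = i) + of_bool (a = j) + of_bool (a = k) + (of_bool (a = l) :: nat)" for a
  have "(\<Prod>a\<in>UNIV. z $ a ^ e a) = z $ i * z $ j * z $ k * z $ l" for z :: "real^'n"
    by (simp add: e_def power_add prod.distrib prod_power_of_bool)
  moreover have "(\<Prod>a\<in>UNIV. std_moment (e a)) = (\<Prod>a\<in>{i,j,k,l}. std_moment (e a))"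
    by (rule prod.mono_neutral_right) (auto simp: e_def)
  \<comment> \<open>Each pattern of coincidences is checked: four equal indices give 3, two distinct
    pairs give 1, and any index of odd multiplicity gives 0.\<close>
  moreover have "(\<Prod>a\<in>{i,j,k,l}. std_moment (e a)) =
      of_bool (i = j \<and> k = l) + of_bool (i = k \<and> j = l) + of_bool (i = l \<and> j = k)"
    unfolding e_def
    by (cases "i = j"; cases "i = k"; cases "i = l"; cases "j = k"; cases "j = l"; cases "k = l")
       (simp_all add: insert_commute numeral_2_eq_2[symmetric] numeral_3_eq_3[symmetric])
  ultimately show ?thesis
    using std_gaussian_monomial[of e] by simp
qed

lemma std_gaussian_moment3:
  fixes i j k :: "'n::finite"
  shows "has_bochner_integral std_gaussian (\<lambda>z. z $ i * z $ j * z $ k) (0::real)"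
proof -
  define e where "e a = of_bool (a = i) + of_bool (a = j) + (of_bool (a = k) :: nat)" for a
  have "(\<Prod>a\<in>UNIV. z $ a ^ e a) = z $ i * z $ j * z $ k" for z :: "real^'n"
    by (simp add: e_def power_add prod.distrib prod_power_of_bool)
  \<comment> \<open>The total degree is odd, so some index has odd multiplicity.\<close>
  moreover have "\<exists>a. std_moment (e a) = 0"
    unfolding e_def
    by (cases "i = j"; cases "i = k"; cases "j = k")
       (auto intro: exI[of _ i] exI[of _ j] exI[of _ k] simp: numeral_2_eq_2[symmetric] numeral_3_eq_3[symmetric])
  then have "(\<Prod>a\<in>UNIV. std_moment (e a)) = 0"
    by (simp add: prod_zero_iff)
  ultimately show ?thesis
    using std_gaussian_monomial[of e] by (simp del: prod_zero_iff)
qed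

lemma std_gaussian_moment2:
  fixes i j :: "'n::finite"
  shows "has_bochner_integral std_gaussian (\<lambda>z. z $ i * z $ j) (of_bool (i = j) :: real)"
proof -
  define e where "e a = of_bool (a = i) + (of_bool (a = j) :: nat)" for a
  have "(\<Prod>a\<in>UNIV. z $ a ^ e a) = z $ i * z $ j" for z :: "real^'n"
    by (simp add: e_def power_add prod.distrib prod_power_of_bool)
  moreover have "(\<Prod>a\<in>UNIV. std_moment (e a)) = (\<Prod>a\<in>{i,j}. std_moment (e a))"
    by (rule prod.mono_neutral_right) (auto simp: e_def)
  moreover have "(\<Prod>a\<in>{i,j}. std_moment (e a)) = of_bool (i = j)"
    by (auto simp: e_def numeral_2_eq_2[symmetric])
  ultimately show ?thesis
    using std_gaussian_monomial[of e] by simp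
qed

lemma std_gaussian_moment1:
  fixes i :: "'n::finite"
  shows "has_bochner_integral std_gaussian (\<lambda>z. z $ i) (0::real)"
proof -
  have "(\<Prod>a\<in>UNIV. std_moment (of_bool (a = i))) = 0"
    by (simp add: prod_zero_iff exI[of _ i])
  then show ?thesis
    using std_gaussian_monomial[of "\<lambda>a. of_bool (a = i)"]
    by (simp add: prod_power_of_bool del: prod_zero_iff)
qed

lemma std_gaussian_inner:
  "has_bochner_integral std_gaussian (\<lambda>z. a \<bullet> z) (0::real)"
proof -
  have "has_bochner_integral std_gaussian (\<lambda>z. \<Sum>i\<in>UNIV. a $ i * z $ i) (\<Sum>i\<in>UNIV. a $ i * 0)"
    by (intro has_bochner_integral_sum has_bochner_integral_mult_right std_gaussian_moment1)
  then show ?thesis by (simp add: inner_vec_def)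
qed

lemma std_gaussian_inner_inner:
  "has_bochner_integral std_gaussian (\<lambda>z. (a \<bullet> z) * (b \<bullet> z)) (a \<bullet> b)"
proof -
  have "has_bochner_integral std_gaussian (\<lambda>z. \<Sum>i\<in>UNIV. \<Sum>j\<in>UNIV. (a $ i * b $ j) * (z $ i * z $ j))
    (\<Sum>i\<in>UNIV. \<Sum>j\<in>UNIV. (a $ i * b $ j) * of_bool (i = j))"
    by (intro has_bochner_integral_sum has_bochner_integral_mult_right std_gaussian_moment2)
  moreover have "(\<Sum>i\<in>UNIV. \<Sum>j\<in>UNIV. (a $ i * b $ j) * of_bool (i = j)) = a \<bullet> b"
    by (simp add: inner_vec_def of_bool_def if_distrib cong: if_cong)
  moreover have "(\<Sum>i\<in>UNIV. \<Sum>j\<in>UNIV. (a $ i * b $ j) * (z $ i * z $ j)) = (a \<bullet> z) * (b \<bullet> z)" for z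
    by (simp add: inner_vec_def sum_product mult_ac)
  ultimately show ?thesis by simp
qed

lemma quadratic_form_sum:
  fixes N :: "real^'n^'n"
  shows "z \<bullet> (N *v z) = (\<Sum>i\<in>UNIV. \<Sum>j\<in>UNIV. N $ i $ j * (z $ i * z $ j))"
  by (simp add: inner_vec_def matrix_vector_mult_def sum_distrib_left mult_ac)

lemma std_gaussian_quadratic:
  "has_bochner_integral std_gaussian (\<lambda>z. z \<bullet> (N *v z)) (trace N)"
proof -
  have "has_bochner_integral std_gaussian (\<lambda>z. \<Sum>i\<in>UNIV. \<Sum>j\<in>UNIV. N $ i $ j * (z $ i * z $ j))
    (\<Sum>i\<in>UNIV. \<Sum>j\<in>UNIV. N $ i $ j * of_bool (i = j))"
    by (intro has_bochner_integral_sum has_bochner_integral_mult_right std_gaussian_moment2)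
  moreover have "(\<Sum>i\<in>UNIV. \<Sum>j\<in>UNIV. N $ i $ j * of_bool (i = j)) = trace N"
    by (simp add: trace_def of_bool_def if_distrib cong: if_cong)
  ultimately show ?thesis by (simp add: quadratic_form_sum)
qed

lemma std_gaussian_inner_quadratic:
  "has_bochner_integral std_gaussian (\<lambda>z. (a \<bullet> z) * (z \<bullet> (N *v z))) (0::real)"
proof -
  have "has_bochner_integral std_gaussian
     (\<lambda>z. \<Sum>k\<in>UNIV. \<Sum>i\<in>UNIV. \<Sum>j\<in>UNIV. (a $ k * N $ i $ j) * (z $ k * z $ i * z $ j))
    (\<Sum>k\<in>UNIV. \<Sum>i\<in>UNIV. \<Sum>j\<in>UNIV. (a $ k * N $ i $ j) * 0)"
    by (intro has_bochner_integral_sum has_bochner_integral_mult_right std_gaussian_moment3)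
  moreover have "(\<Sum>k\<in>UNIV. \<Sum>i\<in>UNIV. \<Sum>j\<in>UNIV. (a $ k * N $ i $ j) * (z $ k * z $ i * z $ j)) =
      (a \<bullet> z) * (z \<bullet> (N *v z))" for z
    unfolding quadratic_form_sum inner_vec_def[of a] inner_real_def sum_distrib_right[of _ UNIV]
    unfolding sum_distrib_left
    by (simp add: mult_ac)
  ultimately show ?thesis by simp
qed

text \<open>The three summands come from the three pairings of \<open>i, j, k, l\<close> in the
  fourth moment.\<close>

lemma std_gaussian_quadratic_quadratic:
  "has_bochner_integral std_gaussian (\<lambda>z. (z \<bullet> (N *v z)) * (z \<bullet> (L *v z)))
    (trace N * trace L + trace (N ** transpose L) + trace (N ** L))"
proof -
  let ?s = "\<lambda>g :: 'a \<Rightarrow> 'a \<Rightarrow> 'a \<Rightarrow> 'a \<Rightarrow> real. \<Sum>i\<in>UNIV. \<Sum>j\<in>UNIV. \<Sum>k\<in>UNIV. \<Sum>l\<in>UNIV. g i j k l"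
  \<comment> \<open>The two nestings allow the condition on the innermost index \<open>l\<close> to
    stand outermost, so that the sums collapse from the inside.\<close>
  have conj: "x * of_bool (P \<and> Q) = (if P then if Q then x else 0 else 0)"
    "x * of_bool (P \<and> Q) = (if Q then if P then x else 0 else 0)" for P Q and x :: real
    by simp_all
  have "has_bochner_integral std_gaussian
     (\<lambda>z. ?s (\<lambda>i j k l. (N $ i $ j * L $ k $ l) * (z $ i * z $ j * z $ k * z $ l)))
     (?s (\<lambda>i j k l. (N $ i $ j * L $ k $ l) *
       (of_bool (i = j \<and> k = l) + of_bool (i = k \<and> j = l) + of_bool (i = l \<and> j = k))))"
    by (intro has_bochner_integral_sum has_bochner_integral_mult_right std_gaussian_moment4)
  moreover have "?s (\<lambda>i j k l. (N $ i $ j * L $ k $ l) * (z $ i * z $ j * z $ k * z $ l)) =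
      (z \<bullet> (N *v z)) * (z \<bullet> (L *v z))" for z
    unfolding quadratic_form_sum sum_distrib_right[of _ UNIV]
    unfolding sum_distrib_left
    by (simp add: mult_ac)
  moreover have tr: "trace X = (\<Sum>i\<in>UNIV. \<Sum>j\<in>UNIV. X $ i $ j * of_bool (i = j))" for X :: "real^'a^'a"
    by (simp add: trace_def of_bool_def if_distrib cong: if_cong)
  have "?s (\<lambda>i j k l. (N $ i $ j * L $ k $ l) * of_bool (i = j \<and> k = l)) = trace N * trace L"
    unfolding tr sum_distrib_right[of _ UNIV]
    unfolding sum_distrib_left
    by (simp add: of_bool_conj mult_ac)
  moreover have "?s (\<lambda>i j k l. (N $ i $ j * L $ k $ l) * of_bool (i = k \<and> j = l)) = trace (N ** transpose L)"
    by (simp add: trace_def matrix_matrix_mult_def transpose_def conj(2))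
  moreover have "?s (\<lambda>i j k l. (N $ i $ j * L $ k $ l) * of_bool (i = l \<and> j = k)) = trace (N ** L)"
    by (simp add: trace_def matrix_matrix_mult_def conj(1))
  ultimately show ?thesis
    by (simp add: distrib_left sum.distrib)
qed

subsection \<open>General Gaussian densities\<close>

lemma inner_matrix_vector_transpose:
  fixes A :: "real^'n^'m"
  shows "x \<bullet> (A *v y) = (transpose A *v x) \<bullet> y"
  by (simp add: dot_lmul_matrix)

text \<open>Gram-Schmidt for the inner product \<open>x \<bullet> (S *v y)\<close>, adding one
  vector at a time.\<close>

lemma pos_definite_orthonormal_family:
  fixes S :: "real^'n^'n"
  assumes "pos_definite S" "k \<le> CARD('n)"
  shows "\<exists>B. finite B \<and> card B = k \<and> (\<forall>x\<in>B. \<forall>y\<in>B. x \<bullet> (S *v y) = of_bool (x = y))"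
  using assms(2)
proof (induction k)
  case 0
  then show ?case by (intro exI[of _ "{}"]) simp
next
  case (Suc k)
  then obtain B where B: "finite B" "card B = k" "\<And>x y. x \<in> B \<Longrightarrow> y \<in> B \<Longrightarrow> x \<bullet> (S *v y) = of_bool (x = y)"
    by auto
  have sym: "x \<bullet> (S *v y) = y \<bullet> (S *v x)" for x y
  proof -
    have "transpose S = S"
      using assms(1) by (simp add: pos_definite_def)
    then show ?thesis
      using inner_matrix_vector_transpose[of x S y] by (simp only: inner_commute)
  qed
  have "dim ((*v) S ` B) \<le> card ((*v) S ` B)"
    using B(1) by (intro dim_le_card') simp
  also have "\<dots> \<le> card B"
    using B(1) by (rule card_image_le)
  finally have dim: "dim ((*v) S ` B) < DIM(real^'n)"
    using B(2) Suc.prems by simp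
  \<comment> \<open>The images of \<open>B\<close> under \<open>S\<close> span a proper subspace, so
    some nonzero vector is orthogonal to them in the Euclidean sense, hence to \<open>B\<close> in
    the inner product of \<open>S\<close>.\<close>
  obtain x where x: "x \<noteq> 0" "\<And>y. y \<in> span ((*v) S ` B) \<Longrightarrow> orthogonal x y"
    using orthogonal_to_subspace_exists[OF dim] by blast
  have xB: "x \<bullet> (S *v b) = 0" if "b \<in> B" for b
    using x(2)[of "S *v b"] that by (simp add: orthogonal_def span_base)
  have xx: "x \<bullet> (S *v x) > 0"
    using assms(1) x(1) by (simp add: pos_definite_def)
  define y where "y = (1 / sqrt (x \<bullet> (S *v x))) *\<^sub>R x"
  have yy: "y \<bullet> (S *v y) = 1"
    using xx by (simp add: y_def matrix_vector_mult_scaleR field_simps)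
  have yB: "y \<bullet> (S *v b) = 0" if "b \<in> B" for b
    using xB[OF that] by (simp add: y_def)
  have By: "b \<bullet> (S *v y) = 0" if "b \<in> B" for b
    unfolding sym[of b y] by (rule yB[OF that])
  have "y \<notin> B"
    using yB[of y] yy by force
  moreover have "u \<bullet> (S *v w) = of_bool (u = w)" if "u \<in> insert y B" "w \<in> insert y B" for u w
    using that \<open>y \<notin> B\<close> by (elim insertE) (simp_all add: B(3) yB By yy, auto)
  ultimately show ?case
    using B(1,2) by (intro exI[of _ "insert y B"]) simp
qed

text \<open>\<open>matrix_inv\<close> is a Hilbert choice of a two-sided inverse. Here one exists,
  so the choice is an inverse, and inverses are unique.\<close>

lemma matrix_inv_eqI:
  fixes A :: "real^'n^'n"
  assumes "A ** B = mat 1"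
  shows "matrix_inv A = B"
proof -
  have BA: "B ** A = mat 1"
    using assms matrix_left_right_inverse by blast
  with assms have "\<exists>B. A ** B = mat 1 \<and> B ** A = mat 1"
    by blast
  then have "A ** matrix_inv A = mat 1 \<and> matrix_inv A ** A = mat 1"
    unfolding matrix_inv_def by (rule someI_ex)
  then have "B ** (A ** matrix_inv A) = B"
    by simp
  then show ?thesis
    by (simp add: matrix_mul_assoc BA)
qed

text \<open>The rows of \<open>J\<close> form an orthonormal basis for the inner product of
  \<open>S\<close>, that is \<open>J ** S ** transpose J = mat 1\<close>. Hence
  \<open>C = S ** transpose J\<close> inverts \<open>J\<close>, and the other identities follow from
  the symmetry of \<open>S\<close>.\<close>

lemma pos_definite_factorization:
  fixes S :: "real^'n^'n"
  assumes "pos_definite S"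
  obtains C J :: "real^'n^'n"
  where "J ** C = mat 1" "C ** J = mat 1" "C ** transpose C = S" "transpose J ** J = matrix_inv S"
proof -
  obtain B where B: "finite B" "card B = CARD('n)" "\<And>x y. x \<in> B \<Longrightarrow> y \<in> B \<Longrightarrow> x \<bullet> (S *v y) = of_bool (x = y)"
    using pos_definite_orthonormal_family[OF assms order_refl] by auto
  then obtain h where h: "bij_betw h (UNIV :: 'n set) B"
    using finite_same_card_bij[of "UNIV :: 'n set" B] by auto
  define J where "J = (\<chi> i. h i)"
  define C where "C = S ** transpose J"
  have "h i \<bullet> (S *v h j) = of_bool (i = j)" for i j
    using B(3)[of "h i" "h j"] h by (auto simp: bij_betw_def inj_on_def)
  moreover have "(J ** C) $ i $ j = h i \<bullet> (S *v h j)" for i j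
    by (simp add: C_def J_def matrix_matrix_mult_def matrix_vector_mult_def transpose_def inner_vec_def)
  ultimately have JC: "J ** C = mat 1"
    by (simp add: vec_eq_iff mat_def)
  then have CJ: "C ** J = mat 1"
    using matrix_left_right_inverse by blast
  have S: "transpose S = S"
    using assms by (simp add: pos_definite_def)
  have "C ** transpose C = (C ** J) ** S"
    by (simp add: C_def matrix_transpose_mul S matrix_mul_assoc)
  then have "C ** transpose C = S"
    by (simp add: CJ)
  moreover have "transpose J ** J = matrix_inv S"
    using CJ by (intro matrix_inv_eqI[symmetric]) (simp add: C_def matrix_mul_assoc)
  ultimately show thesis
    using that JC CJ by blast
qed

lemma det_scaleR:
  fixes A :: "real^'n^'n"
  shows "det (c *\<^sub>R A) = c ^ CARD('n) * det A"
proof -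
  have "c *\<^sub>R A = (\<chi> i. c *s A $ i)"
    by (simp add: vec_eq_iff)
  then show ?thesis
    using det_rows_mul[of "\<lambda>_. c" "\<lambda>i. A $ i"] by simp
qed

section \<open>Standardization of a Gaussian by a factor of its covariance\<close>

context
  fixes S C J :: "real^'n^'n"
  assumes JC: "J ** C = mat 1" and CJ: "C ** J = mat 1"
    and CC: "C ** transpose C = S" and JJ: "transpose J ** J = matrix_inv S"
begin

lemma factor_vec: "J *v (C *v x) = x" "C *v (J *v x) = x"
  using JC CJ by (simp_all add: matrix_vector_mul_assoc)

lemma factor_det: "det C \<noteq> 0" "det S = (det C)\<^sup>2"
proof -
  have "det J * det C = 1"
    using JC by (metis det_mul det_I)
  then show "det C \<noteq> 0" by auto
  show "det S = (det C)\<^sup>2"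
    by (simp add: CC[symmetric] det_mul power2_eq_square)
qed

lemma matrix_inv_factor_vec: "matrix_inv S *v x = transpose J *v (J *v x)"
  by (simp add: JJ[symmetric] matrix_vector_mul_assoc del: transpose_matrix_vector)

text \<open>The quadratic form becomes \<open>z \<bullet> z\<close>, and the Jacobian
  \<open>\<bar>det C\<bar>\<close> cancels the root of \<open>det S\<close> in the normalizing
  constant.\<close>

lemma gaussian_density_factor:
  "gaussian_density m S (m + C *v z) * \<bar>det C\<bar> = (\<Prod>i\<in>UNIV. std_normal_density (z $ i))"
proof -
  have "(C *v z) \<bullet> (matrix_inv S *v (C *v z)) = z \<bullet> z"
    by (simp add: matrix_inv_factor_vec factor_vec inner_matrix_vector_transpose del: transpose_matrix_vector)
  moreover have "det ((2 * pi) *\<^sub>R S) powr (- 1 / 2) = 1 / (sqrt (2 * pi) ^ CARD('n) * \<bar>det C\<bar>)"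
  proof -
    have "(sqrt (2 * pi) ^ CARD('n))\<^sup>2 = ((sqrt (2 * pi))\<^sup>2) ^ CARD('n)"
      by (simp only: power_mult[symmetric] mult.commute)
    then have "det ((2 * pi) *\<^sub>R S) = (sqrt (2 * pi) ^ CARD('n) * \<bar>det C\<bar>)\<^sup>2"
      by (simp add: det_scaleR factor_det(2) power_mult_distrib)
    moreover have "x\<^sup>2 powr (- 1 / 2) = 1 / \<bar>x\<bar>" for x :: real
      using powr_minus_divide[of "x\<^sup>2" "1 / 2"] by (simp add: powr_half_sqrt)
    ultimately show ?thesis
      by (simp only: abs_mult abs_abs) simp
  qed
  moreover have "(\<Prod>i\<in>UNIV. std_normal_density (z $ i)) =
      1 / sqrt (2 * pi) ^ CARD('n) * exp (- (1 / 2) * (z \<bullet> z))"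
    by (simp add: std_normal_density_def prod.distrib exp_sum[symmetric] inner_vec_def sum_distrib_left
        power2_eq_square power_one_over sum_negf sum_divide_distrib prod_dividef)
  ultimately show ?thesis
    using factor_det(1) by (simp add: gaussian_density_def)
qed

lemma density_gaussian_eq_distr:
  "density lborel (gaussian_density m S) = distr std_gaussian borel (\<lambda>z. m + C *v z)"
proof (rule measure_eqI)
  note borel_measurable_matrix_vector_mult[measurable]
  have [measurable]: "gaussian_density m S \<in> borel_measurable borel"
    unfolding gaussian_density_def by measurable
  fix X :: "(real^'n) set"
  assume "X \<in> sets (density lborel (gaussian_density m S))"
  then have [measurable]: "X \<in> sets borel" by simp
  have nonneg: "gaussian_density m S x \<ge> 0" for x
    by (simp add: gaussian_density_def)
  have "emeasure (density lborel (gaussian_density m S)) X =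
      (\<integral>\<^sup>+x. ennreal (gaussian_density m S x) * indicator X x \<partial>lborel)"
    by (simp add: emeasure_density)
  also have "\<dots> = \<bar>det C\<bar> * (\<integral>\<^sup>+z. ennreal (gaussian_density m S (m + C *v z)) * indicator X (m + C *v z) \<partial>lborel)"
    by (rule nn_integral_lborel_affine[OF factor_det(1)]) measurable
  also have "\<dots> = (\<integral>\<^sup>+z. ennreal \<bar>det C\<bar> * (ennreal (gaussian_density m S (m + C *v z)) * indicator X (m + C *v z)) \<partial>lborel)"
    by (rule nn_integral_cmult[symmetric]) measurable
  also have "\<dots> = (\<integral>\<^sup>+z. ennreal (\<Prod>i\<in>UNIV. std_normal_density (z $ i)) * indicator ((\<lambda>z. m + C *v z) -` X) z \<partial>lborel)"
    by (rule nn_integral_cong)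
       (simp add: gaussian_density_factor[of m, symmetric] ennreal_mult nonneg mult_ac indicator_def)
  also have "\<dots> = emeasure std_gaussian ((\<lambda>z. m + C *v z) -` X)"
    unfolding std_gaussian_def by (subst emeasure_density) (auto intro!: measurable_sets_borel[of _ borel])
  also have "\<dots> = emeasure (distr std_gaussian borel (\<lambda>z. m + C *v z)) X"
    by (subst emeasure_distr) simp_all
  finally show "emeasure (density lborel (gaussian_density m S)) X = \<dots>" .
qed simp

text \<open>Reduces integrals against the density to moments of the standard Gaussian, for
  integrands expressed in the standardized variable \<open>J *v (x - m)\<close>.\<close>

lemma has_bochner_integral_gaussian:
  fixes h :: "real^'n \<Rightarrow> real"
  assumes "has_bochner_integral std_gaussian h c"
  shows "has_bochner_integral lborel (\<lambda>x. gaussian_density m S x * h (J *v (x - m))) c"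
proof -
  note borel_measurable_matrix_vector_mult[measurable]
  have G[measurable]: "gaussian_density m S \<in> borel_measurable borel"
    unfolding gaussian_density_def by measurable
  have "h \<in> borel_measurable std_gaussian"
    using assms by (auto simp: has_bochner_integral_iff)
  then have [measurable]: "h \<in> borel_measurable borel"
    by (simp cong: measurable_cong_sets)
  have "has_bochner_integral (distr std_gaussian borel (\<lambda>z. m + C *v z)) (\<lambda>x. h (J *v (x - m))) c"
    using assms by (intro has_bochner_integral_distr) (simp_all add: factor_vec cong: measurable_cong_sets)
  then have "has_bochner_integral (density lborel (gaussian_density m S)) (\<lambda>x. h (J *v (x - m))) c"
    by (simp add: density_gaussian_eq_distr)
  then show ?thesis
    by (auto simp: has_bochner_integral_iff integrable_real_density integral_real_density gaussian_density_def)
qed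

end

subsection \<open>Time derivative of the log-density\<close>

lemma has_vector_derivative_nth:
  fixes X :: "real \<Rightarrow> 'a::euclidean_space^'n"
  assumes "(X has_vector_derivative X') F"
  shows "((\<lambda>s. X s $ i) has_vector_derivative X' $ i) F"
  using bounded_linear.has_vector_derivative[OF bounded_linear_vec_nth assms] .

text \<open>Product rule in each term of the Leibniz expansion. The sum is left as it stands: it is
  evaluated only at the identity, and elsewhere just differentiability matters.\<close>

lemma has_real_derivative_det:
  fixes X :: "real \<Rightarrow> real^'n^'n"
  assumes "\<And>i j. ((\<lambda>s. X s $ i $ j) has_real_derivative X' $ i $ j) (at t within T)"
  shows "((\<lambda>s. det (X s)) has_real_derivative
    (\<Sum>p\<in>{p. p permutes UNIV}. of_int (sign p) *
      (\<Sum>i\<in>UNIV. X' $ i $ p i * (\<Prod>j\<in>UNIV - {i}. X t $ j $ p j)))) (at t within T)"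
proof -
  have "((\<lambda>s. \<Prod>i\<in>UNIV. X s $ i $ p i) has_real_derivative
      (\<Sum>i\<in>UNIV. X' $ i $ p i * (\<Prod>j\<in>UNIV - {i}. X t $ j $ p j))) (at t within T)" for p
  proof -
    have "((\<lambda>s. \<Prod>i\<in>UNIV. X s $ i $ p i) has_derivative
        (\<lambda>h. \<Sum>i\<in>UNIV. X' $ i $ p i * h * (\<Prod>j\<in>UNIV - {i}. X t $ j $ p j))) (at t within T)"
      by (rule has_derivative_prod) (rule assms[unfolded has_field_derivative_def])
    then show ?thesis
      unfolding has_field_derivative_def
      by (rule has_derivative_eq_rhs) (simp add: fun_eq_iff sum_distrib_left mult_ac)
  qed
  then show ?thesis
    unfolding det_def by (intro DERIV_sum DERIV_cmult)
qed

text \<open>Jacobi's formula at the identity. A permutation other than \<open>id\<close> moves at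
  least two points, so after one factor is differentiated an off-diagonal zero remains.\<close>

lemma has_real_derivative_det_mat_1:
  fixes X :: "real \<Rightarrow> real^'n^'n"
  assumes "(X has_vector_derivative X') (at t within T)" "X t = mat 1"
  shows "((\<lambda>s. det (X s)) has_real_derivative trace X') (at t within T)"
proof -
  have "((\<lambda>s. X s $ i $ j) has_real_derivative X' $ i $ j) (at t within T)" for i j
    unfolding has_real_derivative_iff_has_vector_derivative
    by (intro has_vector_derivative_nth assms)
  note D = has_real_derivative_det[OF this]
  have "(\<Sum>i\<in>UNIV. X' $ i $ p i * (\<Prod>j\<in>UNIV - {i}. mat 1 $ j $ p j)) = 0"
    if p: "p permutes UNIV" "p \<noteq> id" for p :: "'n \<Rightarrow> 'n"
  proof (intro sum.neutral ballI)
    fix i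
    \<comment> \<open>If \<open>i\<close> itself is moved, then \<open>p i\<close> is a second moved
      point by injectivity.\<close>
    obtain j where j: "p j \<noteq> j" "j \<noteq> i"
    proof (cases "p i = i")
      case True
      then show thesis using that p(2) by (metis eq_id_iff)
    next
      case False
      have "p (p i) \<noteq> p i"
        using False permutes_inj[OF p(1)] by (auto dest: injD)
      then show thesis using that False by metis
    qed
    then have "(\<Prod>j\<in>UNIV - {i}. mat 1 $ j $ p j) = (0::real)"
      by (auto simp: mat_def intro!: prod_zero bexI[of _ j])
    then show "X' $ i $ p i * (\<Prod>j\<in>UNIV - {i}. mat 1 $ j $ p j) = 0"
      by simp
  qed
  then have "(\<Sum>p\<in>{p. p permutes UNIV}. of_int (sign p) *
      (\<Sum>i\<in>UNIV. X' $ i $ p i * (\<Prod>j\<in>UNIV - {i}. X t $ j $ p j))) =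
      (\<Sum>p\<in>{id}. of_int (sign p) *
      (\<Sum>i\<in>UNIV. X' $ i $ p i * (\<Prod>j\<in>UNIV - {i}. X t $ j $ p j)))"
    unfolding assms(2)
    by (intro sum.mono_neutral_right) (auto simp: permutes_id finite_permutations)
  also have "\<dots> = trace X'"
    by (simp add: assms(2) mat_def trace_def)
  finally show ?thesis
    using D by simp
qed

lemma bounded_bilinear_matrix_vector_mult:
  "bounded_bilinear ((*v) :: real^'n^'m \<Rightarrow> real^'n \<Rightarrow> real^'m)"
  unfolding bilinear_conv_bounded_bilinear[symmetric] bilinear_def
  by (auto intro!: linearI simp: matrix_vector_mult_add_rdistrib matrix_vector_right_distrib
      matrix_vector_mult_scaleR scaleR_matrix_vector_assoc)

text \<open>Cramer's rule shows that the solution \<open>w\<close> of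
  \<open>X s *v w s = y s\<close> is differentiable; the equation then determines its
  derivative.\<close>

lemma has_vector_derivative_matrix_inv_mult:
  fixes X :: "real \<Rightarrow> real^'n^'n" and y :: "real \<Rightarrow> real^'n"
  assumes X: "(X has_vector_derivative X') (at t within T)"
    and y: "(y has_vector_derivative y') (at t within T)"
    and det: "\<And>s. s \<in> T \<Longrightarrow> det (X s) \<noteq> 0"
    and t: "t \<in> T" "at t within T \<noteq> bot"
  shows "((\<lambda>s. matrix_inv (X s) *v y s) has_vector_derivative
    matrix_inv (X t) *v (y' - X' *v (matrix_inv (X t) *v y t))) (at t within T)"
proof -
  define w where "w s = matrix_inv (X s) *v y s" for s
  have inv: "X s ** matrix_inv (X s) = mat 1" "matrix_inv (X s) ** X s = mat 1" if s: "s \<in> T" for s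
  proof -
    obtain B where B: "X s ** B = mat 1" "B ** X s = mat 1"
      using det[OF s] invertible_det_nz[of "X s"] unfolding invertible_def by blast
    then show "X s ** matrix_inv (X s) = mat 1" "matrix_inv (X s) ** X s = mat 1"
      using matrix_inv_eqI[OF B(1)] by simp_all
  qed
  have Xw: "X s *v w s = y s" if "s \<in> T" for s
    using inv[OF that] by (simp add: w_def matrix_vector_mul_assoc)
  have Xd: "((\<lambda>s. X s $ i $ j) has_real_derivative X' $ i $ j) (at t within T)" for i j
    unfolding has_real_derivative_iff_has_vector_derivative
    by (intro has_vector_derivative_nth X)
  have yd: "((\<lambda>s. y s $ i) has_real_derivative y' $ i) (at t within T)" for i
    unfolding has_real_derivative_iff_has_vector_derivative
    by (intro has_vector_derivative_nth y)
  have "(\<lambda>s. w s $ k) differentiable (at t within T)" for k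
  proof -
    \<comment> \<open>The matrix \<open>X s\<close> with its \<open>k\<close>-th column replaced by
      \<open>y s\<close>, as in Cramer's rule.\<close>
    let ?Z = "\<lambda>s. (\<chi> i j. if j = k then y s $ i else X s $ i $ j)"
    have "((\<lambda>s. ?Z s $ i $ j) has_real_derivative
        (\<chi> i j. if j = k then y' $ i else X' $ i $ j) $ i $ j) (at t within T)" for i j
      using Xd yd by simp
    from has_real_derivative_det[OF this]
    have "(\<lambda>s. det (?Z s)) differentiable (at t within T)"
      unfolding has_field_derivative_def differentiable_def by blast
    moreover have "(\<lambda>s. det (X s)) differentiable (at t within T)"
      using has_real_derivative_det[OF Xd] unfolding has_field_derivative_def differentiable_def by blast
    ultimately have "(\<lambda>s. det (?Z s) / det (X s)) differentiable (at t within T)"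
      using det[OF t(1)] by (intro differentiable_divide) auto
    then obtain D where D: "((\<lambda>s. det (?Z s) / det (X s)) has_derivative D) (at t within T)"
      unfolding differentiable_def by blast
    have eq: "w s $ k = det (?Z s) / det (X s)" if "s \<in> T" for s
      using Xw[OF that] by (simp add: cramer[OF det[OF that]])
    show ?thesis
      unfolding differentiable_def by (rule exI, rule has_derivative_transform[OF t(1) eq D])
  qed
  then have "w differentiable (at t within T)"
    by (subst differentiable_componentwise_within) (auto simp: Basis_vec_def inner_axis)
  then obtain w' where w': "(w has_vector_derivative w') (at t within T)"
    using vector_derivative_works by blast
  \<comment> \<open>Both sides of \<open>X s *v w s = y s\<close> are differentiated; uniqueness of
    the derivative within \<open>T\<close> equates the results.\<close>
  have "((\<lambda>s. X s *v w s) has_vector_derivative X t *v w' + X' *v w t) (at t within T)"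
    by (rule bounded_bilinear.has_vector_derivative[OF bounded_bilinear_matrix_vector_mult X w'])
  moreover have "((\<lambda>s. X s *v w s) has_vector_derivative y') (at t within T)"
    by (rule has_vector_derivative_transform[OF t(1) Xw y])
  ultimately have "X t *v w' + X' *v w t = y'"
    using vector_derivative_unique_within[OF t(2)] by blast
  then have "y' - X' *v w t = X t *v w'"
    by (simp add: algebra_simps)
  then have "matrix_inv (X t) *v (y' - X' *v w t) = w'"
    using inv(2)[OF t(1)] by (simp add: matrix_vector_mul_assoc)
  then show ?thesis
    using w' by (simp add: w_def[abs_def])
qed

lemma pos_definite_det:
  fixes S :: "real^'n^'n"
  assumes "pos_definite S"
  shows "det S > 0"
proof -
  obtain C J :: "real^'n^'n" where "J ** C = mat 1" "C ** J = mat 1" "C ** transpose C = S"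
      "transpose J ** J = matrix_inv S"
    using pos_definite_factorization[OF assms] .
  note factor_det[OF this]
  then show ?thesis by simp
qed

lemma transpose_matrix_inv_pos_definite:
  fixes S :: "real^'n^'n"
  assumes "pos_definite S"
  shows "transpose (matrix_inv S) = matrix_inv S"
proof -
  obtain C J :: "real^'n^'n" where "transpose J ** J = matrix_inv S"
    using pos_definite_factorization[OF assms] by metis
  then show ?thesis
    by (metis matrix_transpose_mul transpose_transpose)
qed

lemma has_real_derivative_ln_gaussian_density:
  fixes S :: "real \<Rightarrow> real^'n^'n" and \<mu> :: "real \<Rightarrow> real^'n" and x :: "real^'n"
  assumes pos: "\<And>s. s \<in> T \<Longrightarrow> pos_definite (S s)"
    and S: "(S has_vector_derivative S') (at t within T)"
    and \<mu>: "(\<mu> has_vector_derivative \<mu>') (at t within T)"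
    and t: "t \<in> T" "at t within T \<noteq> bot"
  defines "w \<equiv> matrix_inv (S t) *v (x - \<mu> t)"
  shows "((\<lambda>s. ln (gaussian_density (\<mu> s) (S s) x)) has_real_derivative
    \<mu>' \<bullet> w + (1/2) * (w \<bullet> (S' *v w)) - (1/2) * trace (matrix_inv (S t) ** S')) (at t within T)"
proof -
  let ?P = "matrix_inv (S t)"
  have det: "det (S s) > 0" if "s \<in> T" for s
    using pos_definite_det[OF pos[OF that]] .
  have inv: "?P ** S t = mat 1"
  proof -
    obtain B where B: "S t ** B = mat 1" "B ** S t = mat 1"
      using det[OF t(1)] invertible_det_nz[of "S t"] unfolding invertible_def by auto
    then show ?thesis
      using matrix_inv_eqI[OF B(1)] by simp
  qed
  \<comment> \<open>\<open>det (S s)\<close> equals \<open>det (S t) * det (?P ** S s)\<close>, and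
    \<open>?P ** S s\<close> is the identity at \<open>s = t\<close>, where Jacobi's formula is
    available.\<close>
  have "bounded_linear (\<lambda>X. ?P ** X)"
    by (intro linear_conv_bounded_linear[THEN iffD1] linearI)
       (simp_all add: vec_eq_iff matrix_matrix_mult_def distrib_left sum.distrib sum_distrib_left mult_ac)
  from bounded_linear.has_vector_derivative[OF this S]
  have "((\<lambda>s. det (?P ** S s)) has_real_derivative trace (?P ** S')) (at t within T)"
    by (rule has_real_derivative_det_mat_1) (rule inv)
  then have "((\<lambda>s. det (S t) * det (?P ** S s)) has_real_derivative det (S t) * trace (?P ** S')) (at t within T)"
    by (rule DERIV_cmult)
  moreover have "det (S t) * det (?P ** S s) = det (S s)" for s
  proof -
    have "det ?P * det (S t) = 1"
      using arg_cong[OF inv, of det] by (simp add: det_mul)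
    then show ?thesis
      by (simp add: det_mul mult.assoc[symmetric] mult.commute[of "det (S t)"])
  qed
  ultimately have "((\<lambda>s. det (S s)) has_real_derivative det (S t) * trace (?P ** S')) (at t within T)"
    by simp
  from DERIV_chain2[OF DERIV_ln_divide[OF det[OF t(1)]] this]
  have ln_det: "((\<lambda>s. ln (det (S s))) has_real_derivative trace (?P ** S')) (at t within T)"
    using det[OF t(1)] by simp
  have y: "((\<lambda>s. x - \<mu> s) has_vector_derivative - \<mu>') (at t within T)"
    using \<mu> by (auto intro!: derivative_eq_intros)
  have "((\<lambda>s. matrix_inv (S s) *v (x - \<mu> s)) has_vector_derivative
      ?P *v (- \<mu>' - S' *v (?P *v (x - \<mu> t)))) (at t within T)"
    using det by (intro has_vector_derivative_matrix_inv_mult S y t) force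
  from bounded_bilinear.has_vector_derivative[OF bounded_bilinear_inner y this]
  have quad: "((\<lambda>s. (x - \<mu> s) \<bullet> (matrix_inv (S s) *v (x - \<mu> s))) has_real_derivative
      (x - \<mu> t) \<bullet> (?P *v (- \<mu>' - S' *v w)) + (- \<mu>') \<bullet> w) (at t within T)"
    unfolding has_real_derivative_iff_has_vector_derivative w_def .
  \<comment> \<open>Symmetry of \<open>?P\<close> moves it onto \<open>x - \<mu> t\<close>, so that
    both terms of the product rule are expressed through \<open>w\<close>.\<close>
  have w: "(x - \<mu> t) \<bullet> (?P *v (- \<mu>' - S' *v w)) = w \<bullet> (- \<mu>' - S' *v w)"
    unfolding inner_matrix_vector_transpose[of _ ?P] transpose_matrix_inv_pos_definite[OF pos[OF t(1)]] w_def ..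
  have "(x - \<mu> t) \<bullet> (?P *v (- \<mu>' - S' *v w)) + (- \<mu>') \<bullet> w = - 2 * (\<mu>' \<bullet> w) - w \<bullet> (S' *v w)"
    unfolding w by (simp add: inner_diff_right inner_commute[of w \<mu>'])
  with quad have quad': "((\<lambda>s. (x - \<mu> s) \<bullet> (matrix_inv (S s) *v (x - \<mu> s))) has_real_derivative
      - 2 * (\<mu>' \<bullet> w) - w \<bullet> (S' *v w)) (at t within T)"
    by (simp only:)
  have ln_gauss: "ln (gaussian_density (\<mu> s) (S s) x) =
      - (1/2) * (ln ((2 * pi) ^ CARD('n)) + ln (det (S s)))
      - (1/2) * ((x - \<mu> s) \<bullet> (matrix_inv (S s) *v (x - \<mu> s)))" if "s \<in> T" for s
  proof -
    have "det ((2 * pi) *\<^sub>R S s) = (2 * pi) ^ CARD('n) * det (S s)"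
      by (rule det_scaleR)
    moreover have "\<dots> > 0"
      using det[OF that] by simp
    ultimately show ?thesis
      using det[OF that] by (simp add: gaussian_density_def ln_mult ln_powr del: ln_realpow)
  qed
  have D: "((\<lambda>s. - (1/2) * (ln ((2 * pi) ^ CARD('n)) + ln (det (S s)))
      - (1/2) * ((x - \<mu> s) \<bullet> (matrix_inv (S s) *v (x - \<mu> s)))) has_real_derivative
      - (1/2) * (0 + trace (?P ** S')) - (1/2) * (- 2 * (\<mu>' \<bullet> w) - w \<bullet> (S' *v w))) (at t within T)"
    by (intro DERIV_diff DERIV_cmult DERIV_add DERIV_const ln_det quad')
  have "((\<lambda>s. ln (gaussian_density (\<mu> s) (S s) x)) has_real_derivative
      - (1/2) * (0 + trace (?P ** S')) - (1/2) * (- 2 * (\<mu>' \<bullet> w) - w \<bullet> (S' *v w))) (at t within T)"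
    unfolding has_field_derivative_def
    by (rule has_derivative_transform[OF t(1) _ D[unfolded has_field_derivative_def]]) (rule ln_gauss)
  then show ?thesis
    by (simp add: algebra_simps)
qed

subsection \<open>Algebraic inequality\<close>

lemma inner_self_sum: "x \<bullet> x = (\<Sum>i\<in>UNIV. (x $ i)\<^sup>2)" for x :: "real^'n"
  by (simp add: inner_vec_def power2_eq_square)

lemma matrix_mult_entry_square_le:
  fixes X :: "real^'m^'n" and Y :: "real^'k^'m"
  shows "((X ** Y) $ i $ j)\<^sup>2 \<le> (X $ i \<bullet> X $ i) * (\<Sum>k\<in>UNIV. (Y $ k $ j)\<^sup>2)"
proof -
  have "(X ** Y) $ i $ j = X $ i \<bullet> column j Y"
    by (simp add: matrix_matrix_mult_def inner_vec_def column_def)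
  then show ?thesis
    using Cauchy_Schwarz_ineq[of "X $ i" "column j Y"] unfolding inner_self_sum[of "column j Y"]
    by (simp add: column_def)
qed

text \<open>The algebraic core. In the application the left side is the squared information rate,
  the sum of quotients by \<open>d $ i\<close> is the entropy production, and the last sum collects
  the squared contributions to the entropy rate.\<close>

lemma frobenius_trace_bound:
  fixes L J :: "real^'n^'n" and v d :: "real^'n"
  assumes d: "\<And>i. d $ i > 0"
  shows "(J *v v) \<bullet> (J *v v) + trace ((J ** L) ** transpose (J ** L)) + trace ((J ** L) ** (J ** L)) \<le>
    trace (transpose J ** J) * (\<Sum>i\<in>UNIV. ((v $ i)\<^sup>2 + L $ i \<bullet> L $ i) / d $ i) * (\<Sum>i\<in>UNIV. d $ i)
      + (\<Sum>i\<in>UNIV. ((L ** J) $ i $ i)\<^sup>2)"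
proof -
  define M where "M = L ** J"
  define \<tau> where "\<tau> = trace (transpose J ** J)"
  define r where "r i = (v $ i)\<^sup>2 + L $ i \<bullet> L $ i" for i
  have \<tau>: "\<tau> = (\<Sum>j\<in>UNIV. \<Sum>k\<in>UNIV. (J $ k $ j)\<^sup>2)"
    by (simp add: \<tau>_def trace_def matrix_matrix_mult_def transpose_def power2_eq_square)
  have \<tau>': "\<tau> = (\<Sum>i\<in>UNIV. J $ i \<bullet> J $ i)"
    unfolding \<tau> inner_self_sum by (rule sum.swap)
  have M_le: "(M $ i $ j)\<^sup>2 \<le> \<tau> * r i" for i j
  proof -
    have "(M $ i $ j)\<^sup>2 \<le> (L $ i \<bullet> L $ i) * (\<Sum>k\<in>UNIV. (J $ k $ j)\<^sup>2)"
      unfolding M_def by (rule matrix_mult_entry_square_le)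
    \<comment> \<open>The \<open>j\<close>-th column sum is one nonnegative summand of
      \<open>\<tau>\<close>, and \<open>r i\<close> exceeds \<open>L $ i \<bullet> L $ i\<close> by
      a square.\<close>
    also have "\<dots> \<le> r i * \<tau>"
      unfolding \<tau> r_def
      by (intro mult_mono member_le_sum) (auto intro: sum_nonneg)
    finally show ?thesis by (simp add: mult.commute)
  qed
  have "(J *v v) \<bullet> (J *v v) \<le> \<tau> * (\<Sum>i\<in>UNIV. (v $ i)\<^sup>2)"
  proof -
    have "((J *v v) $ i)\<^sup>2 \<le> (J $ i \<bullet> J $ i) * (v \<bullet> v)" for i
      using Cauchy_Schwarz_ineq[of "J $ i" v] by (simp add: matrix_vector_mul_component)
    then show ?thesis
      unfolding inner_self_sum[of "J *v v"] inner_self_sum[of v, symmetric] \<tau>' sum_distrib_right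
      by (intro sum_mono)
  qed
  moreover have "trace ((J ** L) ** transpose (J ** L)) \<le> \<tau> * (\<Sum>i\<in>UNIV. L $ i \<bullet> L $ i)"
  proof -
    have "trace ((J ** L) ** transpose (J ** L)) = (\<Sum>i\<in>UNIV. \<Sum>j\<in>UNIV. ((J ** L) $ i $ j)\<^sup>2)"
      by (simp add: trace_def matrix_matrix_mult_def[of "J ** L"] transpose_def power2_eq_square)
    also have "\<dots> \<le> (\<Sum>i\<in>UNIV. \<Sum>j\<in>UNIV. (J $ i \<bullet> J $ i) * (\<Sum>k\<in>UNIV. (L $ k $ j)\<^sup>2))"
      by (intro sum_mono matrix_mult_entry_square_le)
    also have "\<dots> = \<tau> * (\<Sum>j\<in>UNIV. \<Sum>k\<in>UNIV. (L $ k $ j)\<^sup>2)"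
      by (simp add: \<tau>' sum_product)
    also have "(\<Sum>j\<in>UNIV. \<Sum>k\<in>UNIV. (L $ k $ j)\<^sup>2) = (\<Sum>i\<in>UNIV. L $ i \<bullet> L $ i)"
      unfolding inner_self_sum by (rule sum.swap)
    finally show ?thesis .
  qed
  ultimately have 1: "(J *v v) \<bullet> (J *v v) + trace ((J ** L) ** transpose (J ** L)) \<le> \<tau> * (\<Sum>i\<in>UNIV. r i)"
    by (simp add: r_def sum.distrib distrib_left)
  define h where "h i j = d $ j / d $ i * (M $ i $ j)\<^sup>2" for i j
  have "2 * (M $ i $ j * M $ j $ i) \<le> h i j + h j i" for i j
  proof -
    \<comment> \<open>The weight that balances the two squares: expanding
      \<open>(a x - y / a)^2 \<ge> 0\<close> yields the factors \<open>d $ j / d $ i\<close> and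
      \<open>d $ i / d $ j\<close>.\<close>
    define a where "a = sqrt (d $ j / d $ i)"
    have a: "a > 0" "a\<^sup>2 = d $ j / d $ i" "(1 / a)\<^sup>2 = d $ i / d $ j"
      using d[of i] d[of j] by (simp_all add: a_def power_divide)
    have "0 \<le> (a * M $ i $ j - 1 / a * M $ j $ i)\<^sup>2"
      by simp
    also have "\<dots> = a\<^sup>2 * (M $ i $ j)\<^sup>2 + (1 / a)\<^sup>2 * (M $ j $ i)\<^sup>2 - 2 * (M $ i $ j * M $ j $ i)"
      using a(1) by (simp add: power2_eq_square field_simps)
    finally show ?thesis
      by (simp add: h_def a)
  qed
  then have "(\<Sum>i\<in>UNIV. \<Sum>j\<in>UNIV. 2 * (M $ i $ j * M $ j $ i)) \<le> (\<Sum>i\<in>UNIV. \<Sum>j\<in>UNIV. h i j + h j i)"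
    by (intro sum_mono)
  also have "\<dots> = 2 * (\<Sum>i\<in>UNIV. \<Sum>j\<in>UNIV. h i j)"
    using sum.swap[of "\<lambda>i j. h j i" UNIV UNIV] by (simp add: sum.distrib)
  finally have "(\<Sum>i\<in>UNIV. \<Sum>j\<in>UNIV. M $ i $ j * M $ j $ i) \<le> (\<Sum>i\<in>UNIV. \<Sum>j\<in>UNIV. h i j)"
    by (simp add: sum_distrib_left[symmetric])
  \<comment> \<open>Off the diagonal \<open>M_le\<close> is used. On the diagonal the weight is 1
    and the entry is kept exactly; the resulting \<open>- \<tau> * r i\<close> pays for the bound
    \<open>1\<close> on the first two terms.\<close>
  also have "\<dots> \<le> (\<Sum>i\<in>UNIV. \<Sum>j\<in>UNIV.
      (if i = j then (M $ i $ i)\<^sup>2 - \<tau> * r i else 0) + \<tau> * (r i / d $ i * d $ j))"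
  proof (intro sum_mono)
    fix i j
    have "d $ j / d $ i * (M $ i $ j)\<^sup>2 \<le> d $ j / d $ i * (\<tau> * r i)"
      using d[of i] d[of j] by (intro mult_left_mono M_le) simp
    then show "h i j \<le> (if i = j then (M $ i $ i)\<^sup>2 - \<tau> * r i else 0) + \<tau> * (r i / d $ i * d $ j)"
      using d[of i] d[of j] by (simp add: h_def mult_ac)
  qed
  also have "\<dots> = (\<Sum>i\<in>UNIV. (M $ i $ i)\<^sup>2) - \<tau> * (\<Sum>i\<in>UNIV. r i)
      + \<tau> * (\<Sum>i\<in>UNIV. r i / d $ i) * (\<Sum>j\<in>UNIV. d $ j)"
    unfolding mult.assoc[of \<tau>] sum_product
    by (simp add: sum.distrib sum_subtractf sum_distrib_left)
  also have "(\<Sum>i\<in>UNIV. \<Sum>j\<in>UNIV. M $ i $ j * M $ j $ i) = trace (M ** M)"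
    by (simp add: trace_def matrix_matrix_mult_def)
  \<comment> \<open>Cyclicity of the trace, as \<open>M = L ** J\<close>.\<close>
  also have "trace (M ** M) = trace ((J ** L) ** (J ** L))"
    unfolding M_def by (metis matrix_mul_assoc trace_mul_sym)
  finally show ?thesis
    using 1 unfolding \<tau>_def[symmetric] M_def[symmetric] r_def[symmetric] by linarith
qed

text \<open>The square expands over all index pairs; those with \<open>i < j\<close> and those with
  \<open>j < i\<close> contribute equally.\<close>

lemma square_sum_minus_pair_sum:
  fixes s :: "real^'n::{finite,linorder}"
  shows "(\<Sum>i\<in>UNIV. s $ i)\<^sup>2 - 2 * pair_sum s = (\<Sum>i\<in>UNIV. (s $ i)\<^sup>2)"
proof -
  let ?g = "\<lambda>(i, j). s $ i * s $ j"
  have "(\<Sum>i\<in>UNIV. s $ i)\<^sup>2 = sum ?g UNIV"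
    by (simp add: power2_eq_square sum_product sum.cartesian_product)
  also have "(UNIV :: ('n \<times> 'n) set) = {(i, j). i < j} \<union> {(i, j). j < i} \<union> {(i, j). i = j}"
    by auto
  also have "sum ?g \<dots> = sum ?g {(i, j). i < j} + sum ?g {(i, j). j < i} + sum ?g {(i, j). i = j}"
    by (subst sum.union_disjoint; (subst sum.union_disjoint)?) auto
  also have "sum ?g {(i, j). j < i} = sum ?g {(i, j). i < j}"
    by (rule sum.reindex_bij_witness[of _ prod.swap prod.swap]) auto
  also have "sum ?g {(i, j). i = j} = (\<Sum>i\<in>UNIV. (s $ i)\<^sup>2)"
    by (rule sum.reindex_bij_witness[of _ "\<lambda>i. (i, i)" fst]) (auto simp: power2_eq_square)
  finally show ?thesis
    by (simp add: pair_sum_def)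
qed

subsection \<open>Thermodynamic quantities of a Gaussian state\<close>

lemma partial_deriv_gaussian_density:
  fixes S :: "real^'n^'n"
  assumes "pos_definite S"
  shows "partial_deriv j (gaussian_density m S) x =
    - gaussian_density m S x * (matrix_inv S *v (x - m)) $ j"
proof -
  let ?P = "matrix_inv S" and ?y = "x - m" and ?e = "axis j 1 :: real^'n"
  have sym: "u \<bullet> (?P *v w) = w \<bullet> (?P *v u)" for u w
  proof -
    have "u \<bullet> (?P *v w) = (?P *v u) \<bullet> w"
      using inner_matrix_vector_transpose[of u ?P w]
      unfolding transpose_matrix_inv_pos_definite[OF assms] .
    then show ?thesis
      by (simp only: inner_commute)
  qed
  \<comment> \<open>Along the \<open>j\<close>-th axis the exponent is a quadratic polynomial in
    \<open>h\<close>; symmetry of \<open>?P\<close> merges the two cross terms into its linear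
    coefficient, which gives the derivative at 0.\<close>
  have "(x + h *\<^sub>R ?e - m) \<bullet> (?P *v (x + h *\<^sub>R ?e - m)) =
      ?y \<bullet> (?P *v ?y) + 2 * h * (?P *v ?y) $ j + h\<^sup>2 * (?e \<bullet> (?P *v ?e))" for h
  proof -
    have "x + h *\<^sub>R ?e - m = ?y + h *\<^sub>R ?e"
      by simp
    moreover have "?e \<bullet> (?P *v ?y) = (?P *v ?y) $ j"
      by (simp add: inner_axis')
    ultimately show ?thesis
      using sym[of ?y ?e]
      by (simp only: matrix_vector_right_distrib matrix_vector_mult_scaleR inner_add_left inner_add_right
          inner_scaleR_left inner_scaleR_right power2_eq_square) (simp add: algebra_simps)
  qed
  then have "(\<lambda>h. gaussian_density m S (x + h *\<^sub>R ?e)) = (\<lambda>h. det ((2 * pi) *\<^sub>R S) powr (- 1 / 2) *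
      exp (- (1 / 2) * (?y \<bullet> (?P *v ?y) + 2 * h * (?P *v ?y) $ j + h\<^sup>2 * (?e \<bullet> (?P *v ?e)))))"
    unfolding gaussian_density_def by simp
  moreover have "((\<lambda>h. c * exp (- (1 / 2) * (a + 2 * h * b + h\<^sup>2 * k))) has_real_derivative
      - (c * exp (- (1 / 2) * a)) * b) (at 0)" for a b c k :: real
    by (auto intro!: derivative_eq_intros)
  ultimately show ?thesis
    unfolding partial_deriv_def by (simp only: DERIV_imp_deriv gaussian_density_def)
qed

lemma matrix_mult_add_right:
  fixes X Y :: "real^'m^'n"
  shows "(X + Y) ** Z = X ** Z + Y ** Z"
  by (simp add: vec_eq_iff matrix_matrix_mult_def distrib_right sum.distrib)

lemma matrix_mult_diagonal_component:
  fixes D :: "real^'n^'n" and X :: "real^'k^'n"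
  assumes "\<And>i j. i \<noteq> j \<Longrightarrow> D $ i $ j = 0"
  shows "(D ** X) $ i $ k = D $ i $ i * X $ i $ k"
proof -
  have "(\<Sum>j\<in>UNIV. D $ i $ j * X $ j $ k) = (\<Sum>j\<in>UNIV. if j = i then D $ i $ i * X $ i $ k else 0)"
    by (rule sum.cong) (use assms in auto)
  then show ?thesis
    by (simp add: matrix_matrix_mult_def)
qed

section \<open>One instant of the process in standardized coordinates\<close>

locale gaussian_instant =
  fixes A :: "real^'n^'n" and B :: "real^'m^'n" and b :: "real^'m" and m :: "real^'n"
    and S C J D :: "real^'n^'n"
  assumes pos: "pos_definite S"
    and JC: "J ** C = mat 1" and CJ: "C ** J = mat 1"
    and CC: "C ** transpose C = S" and JJ: "transpose J ** J = matrix_inv S"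
    and D_diag: "\<And>i j. i \<noteq> j \<Longrightarrow> D $ i $ j = 0"
    and D_pos: "\<And>i. D $ i $ i > 0"
begin

text \<open>\<open>v\<close> is the velocity of the mean, and the current divided by the density is
  the affine field \<open>v + M *v (x - m)\<close>. \<open>N\<close> is \<open>M\<close> conjugated
  by \<open>C\<close>, hence has the same trace.\<close>

definition "v = A *v m + B *v b"
definition "M = A + D ** matrix_inv S"
definition "L = M ** C"
definition "N = J ** L"

abbreviation "q \<equiv> gaussian_density m S"
abbreviation "f \<equiv> linear_drift A B b"

lemmas factor = JC CJ CC JJ

lemma D_mult: "(D ** X) $ i $ k = D $ i $ i * X $ i $ k"
  by (rule matrix_mult_diagonal_component) (rule D_diag)

lemma CJ_cancel: "C *v (J *v x) = x"
  by (rule factor_vec(2)[OF factor])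

lemma PC: "matrix_inv S ** C = transpose J"
  by (simp add: JJ[symmetric] matrix_mul_assoc[symmetric] JC)

lemma LJ: "L ** J = M"
  by (simp add: L_def matrix_mul_assoc[symmetric] CJ)

lemma trace_N: "trace N = trace M"
  unfolding N_def LJ[symmetric] by (rule trace_mul_sym)

lemma q_pos: "q x > 0"
  using pos_definite_det[OF pos] by (simp add: gaussian_density_def det_scaleR)

lemma drift_eq: "f x $ i = v $ i + (A ** C) $ i \<bullet> (J *v (x - m))"
proof -
  have "(A ** C) $ i \<bullet> (J *v (x - m)) = ((A ** C) *v (J *v (x - m))) $ i"
    by (simp add: matrix_vector_mul_component)
  also have "\<dots> = (A *v (x - m)) $ i"
    by (simp only: matrix_vector_mul_assoc[symmetric] CJ_cancel)
  finally show ?thesis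
    by (simp add: linear_drift_def v_def matrix_vector_mult_diff_distrib)
qed

text \<open>The gradient term adds \<open>D ** matrix_inv S\<close> to the drift matrix. After
  standardization this is \<open>D ** transpose J\<close>, because
  \<open>matrix_inv S ** C = transpose J\<close>.\<close>

lemma current_eq: "current f D q i x = q x * (v $ i + L $ i \<bullet> (J *v (x - m)))"
proof -
  have "(\<Sum>j\<in>UNIV. D $ i $ j * partial_deriv j q x) =
      (\<Sum>j\<in>UNIV. if j = i then D $ i $ i * partial_deriv i q x else 0)"
    by (rule sum.cong) (use D_diag in auto)
  then have "current f D q i x = q x * (f x $ i + D $ i $ i * (matrix_inv S *v (x - m)) $ i)"
    by (simp add: current_def partial_deriv_gaussian_density[OF pos] algebra_simps)
  also have "(matrix_inv S *v (x - m)) $ i = transpose J $ i \<bullet> (J *v (x - m))"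
    unfolding matrix_vector_mul_component[symmetric] by (simp only: JJ[symmetric] matrix_vector_mul_assoc)
  also have "D $ i $ i * (transpose J $ i \<bullet> (J *v (x - m))) = (D ** transpose J) $ i \<bullet> (J *v (x - m))"
    by (simp only: inner_vec_def D_mult inner_real_def
        sum_distrib_left mult.assoc)
  also have "f x $ i + (D ** transpose J) $ i \<bullet> (J *v (x - m)) =
      v $ i + (A ** C + D ** transpose J) $ i \<bullet> (J *v (x - m))"
    by (simp add: drift_eq inner_add_left)
  also have "A ** C + D ** transpose J = L"
    by (simp add: L_def M_def matrix_mult_add_right matrix_mul_assoc[symmetric] PC)
  finally show ?thesis .
qed

lemma affine_affine:
  "has_bochner_integral std_gaussian (\<lambda>z. (c + a \<bullet> z) * (c' + a' \<bullet> z)) (c * c' + a \<bullet> (a' :: real^'n))"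
proof -
  have "has_bochner_integral std_gaussian
      (\<lambda>z. c * c' * 1 + c * (a' \<bullet> z) + c' * (a \<bullet> z) + (a \<bullet> z) * (a' \<bullet> z))
      (c * c' * 1 + c * 0 + c' * 0 + a \<bullet> a')"
    by (intro has_bochner_integral_add has_bochner_integral_mult_right std_gaussian_moment0
        std_gaussian_inner std_gaussian_inner_inner)
  then show ?thesis
    by (simp add: algebra_simps)
qed

lemma Pi_current_eq: "Pi_current f D q i = ((v $ i)\<^sup>2 + L $ i \<bullet> L $ i) / D $ i $ i"
proof -
  have "has_bochner_integral std_gaussian (\<lambda>z. (v $ i + L $ i \<bullet> z) * (v $ i + L $ i \<bullet> z) / D $ i $ i)
      ((v $ i * v $ i + L $ i \<bullet> L $ i) / D $ i $ i)"
    by (intro has_bochner_integral_divide affine_affine)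
  from has_bochner_integral_gaussian[OF factor this, of m]
  have "(LINT x|lborel. q x * ((v $ i + L $ i \<bullet> (J *v (x - m))) * (v $ i + L $ i \<bullet> (J *v (x - m))) / D $ i $ i)) =
      (v $ i * v $ i + L $ i \<bullet> L $ i) / D $ i $ i"
    by (rule has_bochner_integral_integral_eq)
  \<comment> \<open>Positivity of the density allows one of the two factors \<open>q x\<close> of
    the squared current to be cancelled.\<close>
  moreover have "(a * e)\<^sup>2 / (c * a) = a * (e * e / c)" if "a > 0" for a c e :: real
    using that by (simp add: power2_eq_square)
  then have "(current f D q i x)\<^sup>2 / (D $ i $ i * q x) =
      q x * ((v $ i + L $ i \<bullet> (J *v (x - m))) * (v $ i + L $ i \<bullet> (J *v (x - m))) / D $ i $ i)" for x
    using q_pos[of x] unfolding current_eq by blast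
  ultimately show ?thesis
    by (simp add: Pi_current_def power2_eq_square)
qed

lemma Phi_current_eq: "Phi_current f D q i = ((v $ i)\<^sup>2 + L $ i \<bullet> (A ** C) $ i) / D $ i $ i"
proof -
  have "has_bochner_integral std_gaussian (\<lambda>z. (v $ i + L $ i \<bullet> z) * (v $ i + (A ** C) $ i \<bullet> z) / D $ i $ i)
      ((v $ i * v $ i + L $ i \<bullet> (A ** C) $ i) / D $ i $ i)"
    by (intro has_bochner_integral_divide affine_affine)
  from has_bochner_integral_gaussian[OF factor this, of m]
  have "(LINT x|lborel. q x * ((v $ i + L $ i \<bullet> (J *v (x - m))) * (v $ i + (A ** C) $ i \<bullet> (J *v (x - m))) / D $ i $ i)) =
      (v $ i * v $ i + L $ i \<bullet> (A ** C) $ i) / D $ i $ i"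
    by (rule has_bochner_integral_integral_eq)
  then show ?thesis
    by (simp add: Phi_current_def current_eq drift_eq power2_eq_square mult.assoc)
qed

text \<open>The squares of \<open>v $ i\<close> cancel. The remaining difference pairs row
  \<open>i\<close> of \<open>L\<close> with row \<open>i\<close> of
  \<open>L - A ** C = D ** transpose J\<close>, and the factor \<open>D $ i $ i\<close> cancels the
  denominator.\<close>

lemma entropy_rate_current_eq: "entropy_rate_current f D q i = M $ i $ i"
proof -
  have "L - A ** C = D ** transpose J"
    by (simp add: L_def M_def matrix_mult_add_right matrix_mul_assoc[symmetric] PC)
  then have "L $ i - (A ** C) $ i = (D ** transpose J) $ i"
    by (metis vector_minus_component)
  then have "L $ i \<bullet> L $ i - L $ i \<bullet> (A ** C) $ i = L $ i \<bullet> (D ** transpose J) $ i"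
    by (metis inner_diff_right)
  also have "\<dots> = D $ i $ i * (L ** J) $ i $ i"
    by (simp add: inner_vec_def D_mult transpose_def
        matrix_matrix_mult_def[of L] sum_distrib_left mult_ac)
  finally show ?thesis
    using D_pos[of i]
    by (simp add: entropy_rate_current_def Pi_current_eq Phi_current_eq LJ diff_divide_distrib[symmetric])
qed

section \<open>The time derivative of the log-density and its moments\<close>

definition "score z = - trace M + (J *v v) \<bullet> z + z \<bullet> (N *v z)"

text \<open>Identifies \<open>score\<close>, in the standardized variable, with the expression in
  \<open>has_real_derivative_ln_gaussian_density\<close>.\<close>

lemma score_eq:
  fixes x
  defines "w \<equiv> matrix_inv S *v (x - m)" and "S' \<equiv> A ** S + S ** transpose A + 2 *\<^sub>R D"
  shows "v \<bullet> w + (1/2) * (w \<bullet> (S' *v w)) - (1/2) * trace (matrix_inv S ** S') = score (J *v (x - m))"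
proof -
  let ?z = "J *v (x - m)"
  have DT: "transpose D = D"
    using D_diag by (auto simp: transpose_def vec_eq_iff) (metis D_diag)
  have SP: "S ** matrix_inv S = mat 1"
  proof -
    have "S ** matrix_inv S = (C ** transpose C) ** (transpose J ** J)"
      by (simp only: CC JJ)
    also have "\<dots> = C ** transpose (J ** C) ** J"
      by (simp only: matrix_transpose_mul matrix_mul_assoc)
    finally show ?thesis
      by (simp add: JC CJ)
  qed
  then have PS: "matrix_inv S ** S = mat 1"
    using matrix_left_right_inverse by blast
  have PT: "transpose (matrix_inv S) = matrix_inv S"
    by (rule transpose_matrix_inv_pos_definite[OF pos])
  have MS: "M ** S = A ** S + D"
    by (simp add: M_def matrix_mult_add_right matrix_mul_assoc[symmetric] PS)
  have MT: "transpose M = transpose A + matrix_inv S ** D"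
    by (simp add: M_def transpose_def vec_eq_iff matrix_matrix_mult_def)
       (use DT PT in \<open>auto simp: transpose_def vec_eq_iff intro!: sum.cong\<close>)
  have SM: "S ** transpose M = S ** transpose A + D"
    by (simp add: MT matrix_add_ldistrib matrix_mul_assoc SP)
  \<comment> \<open>Splitting \<open>2 *\<^sub>R D\<close> evenly makes the covariance velocity a
    matrix plus its transpose; both halves give the same quadratic form and the same trace.\<close>
  have S': "S' = M ** S + S ** transpose M"
    by (simp add: S'_def MS SM scaleR_2)
  have w: "w = transpose J *v ?z"
    unfolding w_def by (rule matrix_inv_factor_vec[OF factor])
  have Sw: "S *v w = C *v ?z"
  proof -
    have "S *v w = x - m"
      by (simp add: w_def matrix_vector_mul_assoc SP)
    then show ?thesis by (simp add: CJ_cancel)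
  qed
  have vw: "v \<bullet> w = (J *v v) \<bullet> ?z"
    unfolding w using inner_matrix_vector_transpose[of v "transpose J" ?z]
    by (simp del: transpose_matrix_vector)
  have "w \<bullet> ((M ** S) *v w) = ?z \<bullet> (N *v ?z)"
  proof -
    have "(M ** S) *v w = L *v ?z"
      by (simp add: matrix_vector_mul_assoc[symmetric] Sw L_def)
    then have "w \<bullet> ((M ** S) *v w) = (transpose J *v ?z) \<bullet> (L *v ?z)"
      by (simp only: w)
    also have "\<dots> = ?z \<bullet> (J *v (L *v ?z))"
      by (rule inner_matrix_vector_transpose[symmetric])
    finally show ?thesis
      by (simp only: N_def matrix_vector_mul_assoc[of J L])
  qed
  moreover have "w \<bullet> ((S ** transpose M) *v w) = w \<bullet> ((M ** S) *v w)"
  proof -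
    have "transpose S = S"
      using pos by (simp add: pos_definite_def)
    then have "transpose (M ** S) = S ** transpose M"
      by (simp add: matrix_transpose_mul)
    then show ?thesis
      using inner_matrix_vector_transpose[of w "M ** S" w] by (simp only: inner_commute)
  qed
  ultimately have quad: "w \<bullet> (S' *v w) = 2 * (?z \<bullet> (N *v ?z))"
    by (simp only: S' matrix_vector_mult_add_rdistrib inner_add_right)
  have "trace (matrix_inv S ** (M ** S)) = trace M"
    by (subst trace_mul_sym) (simp add: matrix_mul_assoc[symmetric] SP)
  moreover have "trace (matrix_inv S ** (S ** transpose M)) = trace M"
    by (simp add: matrix_mul_assoc PS trace_def transpose_def)
  ultimately have "trace (matrix_inv S ** S') = 2 * trace M"
    by (simp add: S' matrix_add_ldistrib trace_add)
  then show ?thesis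
    by (simp add: vw quad score_def)
qed

text \<open>Odd moments vanish, and since \<open>trace N = trace M\<close> the squared traces
  cancel.\<close>

lemma score_square:
  "has_bochner_integral std_gaussian (\<lambda>z. (score z)\<^sup>2)
    ((J *v v) \<bullet> (J *v v) + trace (N ** transpose N) + trace (N ** N))"
proof -
  let ?a = "J *v v" and ?\<tau> = "trace M"
  have "has_bochner_integral std_gaussian
      (\<lambda>z. ?\<tau>\<^sup>2 * 1 + (?a \<bullet> z) * (?a \<bullet> z) + (z \<bullet> (N *v z)) * (z \<bullet> (N *v z))
        + 2 * ((?a \<bullet> z) * (z \<bullet> (N *v z))) + (- 2 * ?\<tau>) * (?a \<bullet> z) + (- 2 * ?\<tau>) * (z \<bullet> (N *v z)))
      (?\<tau>\<^sup>2 * 1 + ?a \<bullet> ?a + (trace N * trace N + trace (N ** transpose N) + trace (N ** N))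
        + 2 * 0 + (- 2 * ?\<tau>) * 0 + (- 2 * ?\<tau>) * trace N)"
    by (intro has_bochner_integral_add has_bochner_integral_mult_right std_gaussian_moment0
        std_gaussian_inner std_gaussian_inner_inner std_gaussian_quadratic std_gaussian_inner_quadratic
        std_gaussian_quadratic_quadratic)
  then show ?thesis
    by (simp add: score_def trace_N power2_eq_square algebra_simps)
qed

text \<open>The second factor is the log-density up to the choice of \<open>k\<close>. The norm is
  written as the quadratic form of \<open>mat 1\<close> to use the moment formulas; the terms in
  \<open>k\<close> and in the dimension cancel.\<close>

lemma score_log_density:
  "has_bochner_integral std_gaussian (\<lambda>z. score z * (k - (1/2) * (z \<bullet> z))) (- trace M)"
proof -
  let ?a = "J *v v" and ?\<tau> = "trace M" and ?I = "mat 1 :: real^'n^'n"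
  have "has_bochner_integral std_gaussian
      (\<lambda>z. (- k * ?\<tau>) * 1 + k * (?a \<bullet> z) + k * (z \<bullet> (N *v z)) + (?\<tau> / 2) * (z \<bullet> (?I *v z))
        + (- 1/2) * ((?a \<bullet> z) * (z \<bullet> (?I *v z))) + (- 1/2) * ((z \<bullet> (N *v z)) * (z \<bullet> (?I *v z))))
      ((- k * ?\<tau>) * 1 + k * 0 + k * trace N + (?\<tau> / 2) * trace ?I + (- 1/2) * 0
        + (- 1/2) * (trace N * trace ?I + trace (N ** transpose ?I) + trace (N ** ?I)))"
    by (intro has_bochner_integral_add has_bochner_integral_mult_right std_gaussian_moment0
        std_gaussian_inner std_gaussian_quadratic std_gaussian_inner_quadratic
        std_gaussian_quadratic_quadratic)
  then show ?thesis
    by (simp add: score_def trace_N algebra_simps transpose_mat)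
qed

lemma integral_score_square:
  "(LINT x|lborel. q x * (score (J *v (x - m)))\<^sup>2) =
    (J *v v) \<bullet> (J *v v) + trace (N ** transpose N) + trace (N ** N)"
  by (rule has_bochner_integral_integral_eq[OF has_bochner_integral_gaussian[OF factor score_square]])

lemma integral_score_ln:
  "(LINT x|lborel. q x * score (J *v (x - m)) * ln (q x)) = - trace M"
proof -
  \<comment> \<open>The logarithm of the normalizing constant.\<close>
  define k where "k = ln (det ((2 * pi) *\<^sub>R S) powr (-1/2))"
  have "det S > 0"
    by (rule pos_definite_det[OF pos])
  moreover have "(x - m) \<bullet> (matrix_inv S *v (x - m)) = (J *v (x - m)) \<bullet> (J *v (x - m))" for x
    unfolding matrix_inv_factor_vec[OF factor] inner_matrix_vector_transpose
    by (simp only: transpose_transpose)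
  ultimately have "ln (q x) = k - (1/2) * ((J *v (x - m)) \<bullet> (J *v (x - m)))" for x
    by (simp add: gaussian_density_def ln_mult k_def det_scaleR)
  then show ?thesis
    using has_bochner_integral_integral_eq[OF has_bochner_integral_gaussian[OF factor score_log_density[of k], of m]]
    by (simp only: mult.assoc)
qed

lemma trace_bound:
  "(J *v v) \<bullet> (J *v v) + trace (N ** transpose N) + trace (N ** N) \<le>
    trace (matrix_inv S) * entropy_production f D q * trace D
      + (\<Sum>i\<in>UNIV. (entropy_rate_current f D q i)\<^sup>2)"
  using frobenius_trace_bound[of "\<chi> i. D $ i $ i" J v L] D_pos
  by (simp add: N_def[symmetric] JJ LJ entropy_production_def Pi_current_eq entropy_rate_current_eq trace_def[of D])

end

section \<open>The bound at every time\<close>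

theorem mainTheorem2:
  fixes A :: "real^'n::{finite,linorder}^'n::_"
    and B :: "real^'m^'n::_"
    and u :: "real \<Rightarrow> real^'m"
    and D S :: "real \<Rightarrow> real^'n::_^'n::_"
    and \<mu> :: "real \<Rightarrow> real^'n::_"
    and p :: "real \<Rightarrow> real^'n::_ \<Rightarrow> real"
    and f :: "real \<Rightarrow> real^'n::_ \<Rightarrow> real^'n::_"
    and T :: "real set"
    and t :: real
  assumes T_interval: "is_interval T" "interior T \<noteq> {}"
    and u_cont: "continuous_on T u"
    and D_diag: "\<And>s i j. s \<in> T \<Longrightarrow> i \<noteq> j \<Longrightarrow> D s $ i $ j = 0"
    and D_pos: "\<And>s i. s \<in> T \<Longrightarrow> D s $ i $ i > 0"
    and S_pos: "\<And>s. s \<in> T \<Longrightarrow> pos_definite (S s)"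
    and mean: "\<And>s. s \<in> T \<Longrightarrow>
      (\<mu> has_vector_derivative (A *v \<mu> s + B *v u s)) (at s within T)"
    and covariance: "\<And>s. s \<in> T \<Longrightarrow>
      (S has_vector_derivative (A ** S s + S s ** transpose A + 2 *\<^sub>R D s)) (at s within T)"
    and f: "\<And>s. s \<in> T \<Longrightarrow> f s = linear_drift A B (u s)"
    and p: "\<And>s. s \<in> T \<Longrightarrow> p s = gaussian_density (\<mu> s) (S s)"
    and t: "t \<in> T"
  shows "0 \<le> (information_rate T p t)\<^sup>2 \<and>
    (information_rate T p t)\<^sup>2 \<le>
      trace (matrix_inv (S t)) * entropy_production (f t) (D t) (p t) * trace (D t)
      + (entropy_rate T p t)\<^sup>2
      - 2 * pair_sum (\<chi> i. entropy_rate_current (f t) (D t) (p t) i)"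
proof -
  obtain C J :: "real^'n::_^'n::_" where factor: "J ** C = mat 1" "C ** J = mat 1" "C ** transpose C = S t"
      "transpose J ** J = matrix_inv (S t)"
    using pos_definite_factorization[OF S_pos[OF t]] .
  interpret G: gaussian_instant A B "u t" "\<mu> t" "S t" C J "D t"
    using factor S_pos[OF t] D_diag[OF t] D_pos[OF t] by unfold_locales
  \<comment> \<open>An interval with interior points is connected and not a singleton, so
    \<open>t\<close> is a limit point of \<open>T\<close> and derivatives within \<open>T\<close>
    are unique.\<close>
  have "T \<noteq> {x}" for x
    using T_interval(2) by auto
  then have nontrivial: "at t within T \<noteq> bot"
    unfolding trivial_limit_within
    using connected_imp_perfect[OF is_interval_connected[OF T_interval(1)] t] by blast
  have ln_p: "((\<lambda>s. ln (p s x)) has_vector_derivative G.score (J *v (x - \<mu> t))) (at t within T)" for x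
  proof -
    have "((\<lambda>s. ln (gaussian_density (\<mu> s) (S s) x)) has_vector_derivative
        G.score (J *v (x - \<mu> t))) (at t within T)"
      using has_real_derivative_ln_gaussian_density[OF S_pos covariance[OF t] mean[OF t] t nontrivial, of x]
      unfolding G.v_def[symmetric] G.score_eq has_real_derivative_iff_has_vector_derivative .
    then show ?thesis
      by (rule has_vector_derivative_transform[OF t, rotated]) (simp add: p)
  qed
  have p_deriv: "((\<lambda>s. p s x) has_vector_derivative p t x * G.score (J *v (x - \<mu> t))) (at t within T)" for x
  proof -
    have p_pos: "p s x > 0" if "s \<in> T" for s
      using pos_definite_det[OF S_pos[OF that]] by (simp add: p[OF that] gaussian_density_def det_scaleR)
    \<comment> \<open>The derivative of the density is recovered from that of its logarithm, through
      \<open>p = exp (ln p)\<close> on \<open>T\<close>.\<close>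
    have "((\<lambda>s. exp (ln (p s x))) has_real_derivative exp (ln (p t x)) * G.score (J *v (x - \<mu> t))) (at t within T)"
      using ln_p[of x] unfolding has_real_derivative_iff_has_vector_derivative[symmetric]
      by (rule DERIV_chain2[OF DERIV_exp])
    then have "((\<lambda>s. exp (ln (p s x))) has_vector_derivative p t x * G.score (J *v (x - \<mu> t))) (at t within T)"
      by (simp add: p_pos[OF t] has_real_derivative_iff_has_vector_derivative)
    then show ?thesis
      by (rule has_vector_derivative_transform[OF t, rotated]) (simp add: p_pos)
  qed
  have rate: "entropy_rate T p t = trace G.M"
    using G.integral_score_ln
    by (simp add: entropy_rate_def vector_derivative_within[OF nontrivial p_deriv] p[OF t])
  have info: "(information_rate T p t)\<^sup>2 =
      (LINT x|lborel. gaussian_density (\<mu> t) (S t) x * (G.score (J *v (x - \<mu> t)))\<^sup>2)"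
  proof -
    \<comment> \<open>Nonnegativity of the integral lets the square undo the root in
      \<open>information_rate\<close>.\<close>
    have "0 \<le> (LINT x|lborel. gaussian_density (\<mu> t) (S t) x * (G.score (J *v (x - \<mu> t)))\<^sup>2)"
      by (intro Bochner_Integration.integral_nonneg) (simp add: gaussian_density_def)
    then show ?thesis
      by (simp add: information_rate_def vector_derivative_within[OF nontrivial ln_p] p[OF t])
  qed
  \<comment> \<open>The contributions of the currents add up to the entropy rate, so subtracting
    twice the pair sum from its square leaves the sum of their squares.\<close>
  have "trace G.M = (\<Sum>i\<in>UNIV. entropy_rate_current (f t) (D t) (p t) i)"
    by (simp add: f[OF t] p[OF t] G.entropy_rate_current_eq trace_def)
  then have "(entropy_rate T p t)\<^sup>2 - 2 * pair_sum (\<chi> i. entropy_rate_current (f t) (D t) (p t) i) =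
      (\<Sum>i\<in>UNIV. (entropy_rate_current (f t) (D t) (p t) i)\<^sup>2)"
    using square_sum_minus_pair_sum[of "\<chi> i. entropy_rate_current (f t) (D t) (p t) i"] rate by simp
  then show ?thesis
    using G.trace_bound info G.integral_score_square zero_le_power2[of "information_rate T p t"]
    by (simp only: f[OF t] p[OF t] simp_thms)
qed

end
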